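(* Let $0<p<1$ and let $\mu_p$ be a probability measure on $[0,1]$, absolutely continuous with respect to Lebesgue measure with density of bounded variation, such that $m_p\otimes\mu_p$ is invariant for $R$. Then the random transformation $R$ is mixing with respect to $m_p\otimes\mu_p$.
   Context: $\Omega=\{0,1\}^{\mathbb{N}}$ with elements $\omega=(\omega_k)_{k\ge1}$, and $\sigma$ is the left shift on $\Omega$. The Gauss map $T_0:[0,1]\to[0,1]$ is $T_0(0)=0$ and $T_0x=\frac1x \pmod 1$ for $x\ne0$; the R\'enyi map $T_1:[0,1]\to[0,1]$ is $T_1(1)=0$ and $T_1x=\frac1{1-x}\pmod 1$ for $x\neq1$. The map $R:\Omega\times[0,1]\to\Omega\times[0,1]$ is $R(\omega,x)=(\sigma\omega,T_{\omega_1}x)$. $m_p$ is the $(p,1-p)$-Bernoulli measure on $\Omega$ (symbol $0$ has probability $p$, symbol $1$ has probability $1-p$). Such a measure $\mu_p$ exists for every $0<p<1$. *)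

theory Defs
  imports "HOL-Probability.Probability"
begin

(* The symbols 0 and 1 are represented by False and True. A point (omega_k), k >= 1, of Omega
   is a bool stream: shd is omega_1 and stl is the left shift. *)

definition gauss_map :: "real \<Rightarrow> real" where
  "gauss_map x = (if x = 0 then 0 else frac (1 / x))"

definition renyi_map :: "real \<Rightarrow> real" where
  "renyi_map x = (if x = 1 then 0 else frac (1 / (1 - x)))"

definition random_cf_map :: "bool stream \<times> real \<Rightarrow> bool stream \<times> real" where
  "random_cf_map = (\<lambda>(\<omega>, x). (stl \<omega>, (if shd \<omega> then renyi_map else gauss_map) x))"

(* bernoulli_pmf q gives probability q to True, that is, to the symbol 1; hence q = 1 - p. *)
definition bernoulli_measure :: "real \<Rightarrow> bool stream measure" where
  "bernoulli_measure p = stream_space (measure_pmf (bernoulli_pmf (1 - p)))"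

(* Lebesgue measure on the Borel sets of the unit interval. *)
definition unit_lebesgue :: "real measure" where
  "unit_lebesgue = restrict_space lborel {0..1}"

(* The sums are over finite partitions x 0 <= ... <= x n with all points in S. *)
definition bounded_variation_on :: "(real \<Rightarrow> real) \<Rightarrow> real set \<Rightarrow> bool" where
  "bounded_variation_on f S \<longleftrightarrow>
     (\<exists>V. \<forall>n. \<forall>x :: nat \<Rightarrow> real.
        (\<forall>i\<le>n. x i \<in> S) \<and> (\<forall>i<n. x i \<le> x (Suc i)) \<longrightarrow>
        (\<Sum>i<n. \<bar>f (x (Suc i)) - f (x i)\<bar>) \<le> V)"

(* Densities are defined up to null sets: some version is required to have bounded variation. *)
definition has_bv_density :: "real measure \<Rightarrow> bool" where
  "has_bv_density \<mu> \<longleftrightarrow>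
     (\<exists>h. h \<in> borel_measurable unit_lebesgue \<and> (\<forall>x\<in>{0..1}. 0 \<le> h x) \<and>
          bounded_variation_on h {0..1} \<and>
          \<mu> = density unit_lebesgue (\<lambda>x. ennreal (h x)))"

definition invariant_measure :: "('a \<Rightarrow> 'a) \<Rightarrow> 'a measure \<Rightarrow> bool" where
  "invariant_measure T M \<longleftrightarrow>
     T \<in> measurable M M \<and> (\<forall>A\<in>sets M. emeasure M (T -` A \<inter> space M) = emeasure M A)"

definition mixing :: "('a \<Rightarrow> 'a) \<Rightarrow> 'a measure \<Rightarrow> bool" where
  "mixing T M \<longleftrightarrow>
     invariant_measure T M \<and>
     (\<forall>A\<in>sets M. \<forall>B\<in>sets M.
        (\<lambda>n. measure M (((T ^^ n) -` A \<inter> space M) \<inter> B)) \<longlonglongrightarrow> measure M A * measure M B)"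

(* The measurability clause in invariant_measure is automatic for the map under consideration. *)
lemma random_cf_map_measurable:
  assumes "sets \<mu> = sets unit_lebesgue"
  shows "random_cf_map \<in> measurable (bernoulli_measure p \<Otimes>\<^sub>M \<mu>) (bernoulli_measure p \<Otimes>\<^sub>M \<mu>)"
proof -
  let ?B = "measure_pmf (bernoulli_pmf (1 - p))"
  let ?S = "bernoulli_measure p"
  have S: "sets \<mu> = sets (restrict_space borel {0..1})"
    using assms by (simp add: unit_lebesgue_def sets_restrict_space)
  have snd_borel: "snd \<in> measurable (?S \<Otimes>\<^sub>M \<mu>) borel"
    using measurable_snd[of ?S \<mu>] S
    by (simp add: measurable_cong_sets[OF refl S] measurable_restrict_space2_iff)
  have stl: "(\<lambda>z. stl (fst z)) \<in> measurable (?S \<Otimes>\<^sub>M \<mu>) ?S"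
    unfolding bernoulli_measure_def by measurable
  have hd: "(\<lambda>z. shd (fst z)) \<in> measurable (?S \<Otimes>\<^sub>M \<mu>) (count_space UNIV)"
  proof -
    have "(\<lambda>z. shd (fst z)) \<in> measurable (?S \<Otimes>\<^sub>M \<mu>) ?B"
      unfolding bernoulli_measure_def by measurable
    then show ?thesis by simp
  qed
  have g: "gauss_map \<in> borel_measurable borel" and r: "renyi_map \<in> borel_measurable borel"
    unfolding gauss_map_def [abs_def] renyi_map_def [abs_def] frac_def by measurable
  have "(\<lambda>z. (if shd (fst z) then renyi_map (snd z) else gauss_map (snd z)))
      \<in> measurable (?S \<Otimes>\<^sub>M \<mu>) borel"
    using hd measurable_compose[OF snd_borel g] measurable_compose[OF snd_borel r]
    by (intro measurable_If) (auto simp: pred_def)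
  moreover have "renyi_map x \<in> {0..1}" "gauss_map x \<in> {0..1}" for x
    by (auto simp: renyi_map_def gauss_map_def less_imp_le[OF frac_lt_1])
  ultimately have "(\<lambda>z. (if shd (fst z) then renyi_map (snd z) else gauss_map (snd z)))
      \<in> measurable (?S \<Otimes>\<^sub>M \<mu>) \<mu>"
    unfolding measurable_cong_sets[OF refl S] by (intro measurable_restrict_space2) auto
  from measurable_Pair[OF stl this] show ?thesis
    by (simp add: random_cf_map_def case_prod_beta if_distrib[of "\<lambda>f. f _"] cong: if_cong)
qed

end

(* Every inverse branch, Gauss or Renyi, maps the family of probability densities
   g_t(x) = (1 + t) / (1 + t x)^2, t >= 0, to itself up to factors. A Gauss branch sends t into
   [0, 1], where g_t >= 1/2; hence the image of g_t under any positive number of steps of the random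
   map dominates p/2 times Lebesgue measure. As an n-step cylinder has length at most 1/(n + 1),
   cylinders approximate every measurable set, and so the n-step image of any absolutely continuous
   measure is asymptotically at least p/2 times its mass times the reference measure
   m_p x Lebesgue. By the lower-function argument of Lasota and Yorke, the images of two absolutely
   continuous measures of equal mass then merge in total variation. Applied to the restriction of
   the invariant measure M to B and to M(B) M, this is mixing. *)

theory Submission
  imports Defs
begin

section \<open>Merging from an asymptotic lower bound\<close>

text \<open>The measure \<open>M\<close> of this locale is a reference measure and need not be
  invariant: \<open>T\<close> only has to be nonsingular for it, so that images of absolutely
  continuous measures stay absolutely continuous and can be compared again. The obstacle is the
  neutral fixed point 0 of the Renyi map. Its first branch moves the parameter t to 1 + t, so long
  runs of it concentrate mass near 0; distortion along inverse branches is unbounded, and no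
  positive lower bound holds for all words of symbols at once. A Gauss step resets the parameter to
  [0, 1] whatever the past was. Only the last step has to be of this kind, which has probability p;
  together with the minimum 1 / (1 + t) >= 1/2 of the density this gives the same constant p/2 at
  every time. The same fixed point makes the decay of cylinder lengths merely harmonic, but the
  approximation needs no rate.\<close>

locale asymptotic_lower_bound = prob_space M for M :: "'a measure" +
  fixes T :: "'a \<Rightarrow> 'a" and c :: real
  assumes T_measurable [measurable]: "T \<in> measurable M M"
    and nonsingular: "absolutely_continuous M (distr M M T)"
    and c_pos: "0 < c" and c_le_1: "c \<le> 1"
    and lower_bound: "\<And>B e. B \<in> sets M \<Longrightarrow> 0 < e \<Longrightarrow>
      \<exists>N. \<forall>n\<ge>N. \<forall>A\<in>sets M.
        c * measure M B * measure M A \<le> measure M ((T ^^ n) -` A \<inter> space M \<inter> B) + e"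
begin

lemma funpow_measurable [measurable]: "T ^^ n \<in> measurable M M"
  by (induction n) (auto intro: measurable_compose[OF _ T_measurable] simp: comp_def)

lemma funpow_space: "x \<in> space M \<Longrightarrow> (T ^^ n) x \<in> space M"
  by (rule measurable_space[OF funpow_measurable])

text \<open>Both sides are linear in the density, so the bound passes from indicators to simple
  functions; a monotone limit costs only the mass that is still missing, because \<open>c\<close>
  times the measure of \<open>A\<close> is at most 1. The time \<open>N\<close> stays uniform in
  \<open>A\<close>, without which the contraction below could not be repeated.\<close>

lemma lower_bound_nn_integral:
  assumes "u \<in> borel_measurable M" and "integral\<^sup>N M u < \<infinity>" and "0 < e"
  shows "\<exists>N. \<forall>n\<ge>N. \<forall>A\<in>sets M.
    ennreal c * integral\<^sup>N M u * emeasure M A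
      \<le> (\<integral>\<^sup>+x. u x * indicator ((T ^^ n) -` A \<inter> space M) x \<partial>M) + ennreal e"
  using assms
proof (induct arbitrary: e)
  case (cong f g)
  have "integral\<^sup>N M f = integral\<^sup>N M g"
    "\<And>X. (\<integral>\<^sup>+x. f x * indicator X x \<partial>M) = (\<integral>\<^sup>+x. g x * indicator X x \<partial>M)"
    using cong(3) by (auto intro!: nn_integral_cong)
  with cong show ?case by auto
next
  case (set B)
  obtain N where N: "\<And>n A. n \<ge> N \<Longrightarrow> A \<in> sets M \<Longrightarrow>
      c * measure M B * measure M A \<le> measure M ((T ^^ n) -` A \<inter> space M \<inter> B) + e"
    using lower_bound[OF set(1,3)] by blast
  show ?case
  proof (intro exI allI impI ballI)
    fix n A assume n: "n \<ge> N" and A [measurable]: "A \<in> sets M"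
    have "(\<integral>\<^sup>+x. indicator B x * indicator ((T ^^ n) -` A \<inter> space M) x \<partial>M)
        = (\<integral>\<^sup>+x. indicator ((T ^^ n) -` A \<inter> space M \<inter> B) x \<partial>M)"
      by (intro nn_integral_cong) (auto split: split_indicator)
    also have "\<dots> = measure M ((T ^^ n) -` A \<inter> space M \<inter> B)"
      using set(1) by (simp add: emeasure_eq_measure)
    finally show "ennreal c * integral\<^sup>N M (indicator B) * emeasure M A
        \<le> (\<integral>\<^sup>+x. indicator B x * indicator ((T ^^ n) -` A \<inter> space M) x \<partial>M) + ennreal e"
      using N[OF n A] set(1,3) c_pos
      by (simp add: emeasure_eq_measure ennreal_mult[symmetric] ennreal_plus[symmetric]
          del: ennreal_plus)
  qed
next
  case (mult u k)
  show ?case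
  proof (cases "k = 0")
    case True
    then show ?thesis by simp
  next
    case False
    obtain k' where k': "k = ennreal k'" "0 \<le> k'" using mult(1) by (cases k) auto
    with False have "0 < k'" by auto
    have fin: "integral\<^sup>N M u < \<infinity>"
      using mult(2,5) False by (auto simp: nn_integral_cmult ennreal_mult_less_top)
    have "0 < e / k'" using \<open>0 < k'\<close> mult(6) by simp
    from mult(4)[OF fin this] obtain N where N: "\<And>n A. n \<ge> N \<Longrightarrow> A \<in> sets M \<Longrightarrow>
      ennreal c * integral\<^sup>N M u * emeasure M A
      \<le> (\<integral>\<^sup>+x. u x * indicator ((T ^^ n) -` A \<inter> space M) x \<partial>M) + ennreal (e / k')" by blast
    show ?thesis
    proof (intro exI allI impI ballI)
      fix n A assume n: "n \<ge> N" and A [measurable]: "A \<in> sets M"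
      have [measurable]: "u \<in> borel_measurable M" by fact
      have "k * ennreal (e / k') = ennreal e"
        using k' \<open>0 < k'\<close> mult(6) by (simp add: ennreal_mult[symmetric])
      moreover have "(\<integral>\<^sup>+x. k * u x * indicator ((T ^^ n) -` A \<inter> space M) x \<partial>M)
          = k * (\<integral>\<^sup>+x. u x * indicator ((T ^^ n) -` A \<inter> space M) x \<partial>M)"
        by (simp add: mult.assoc nn_integral_cmult)
      ultimately show "ennreal c * (\<integral>\<^sup>+x. k * u x \<partial>M) * emeasure M A
        \<le> (\<integral>\<^sup>+x. k * u x * indicator ((T ^^ n) -` A \<inter> space M) x \<partial>M) + ennreal e"
        using mult_left_mono[OF N[OF n A], of k]
        by (simp add: nn_integral_cmult distrib_left mult_ac)
    qed
  qed
next
  case (add u v)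
  have [measurable]: "u \<in> borel_measurable M" "v \<in> borel_measurable M" by fact+
  have "integral\<^sup>N M u < \<infinity>" "integral\<^sup>N M v < \<infinity>"
    using add(8) by (auto simp: nn_integral_add)
  moreover have e2: "0 < e / 2" using add(9) by simp
  ultimately obtain N1 N2 where N: "\<And>n A. n \<ge> N1 \<Longrightarrow> A \<in> sets M \<Longrightarrow>
      ennreal c * integral\<^sup>N M u * emeasure M A
      \<le> (\<integral>\<^sup>+x. u x * indicator ((T ^^ n) -` A \<inter> space M) x \<partial>M) + ennreal (e / 2)"
    "\<And>n A. n \<ge> N2 \<Longrightarrow> A \<in> sets M \<Longrightarrow>
      ennreal c * integral\<^sup>N M v * emeasure M A
      \<le> (\<integral>\<^sup>+x. v x * indicator ((T ^^ n) -` A \<inter> space M) x \<partial>M) + ennreal (e / 2)"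
    using add(3)[OF _ e2] add(7)[OF _ e2] by blast
  show ?case
  proof (intro exI allI impI ballI)
    fix n A assume n: "n \<ge> max N1 N2" and A [measurable]: "A \<in> sets M"
    have "ennreal (e / 2) + ennreal (e / 2) = ennreal e"
      using add(9) by (simp add: ennreal_plus[symmetric] del: ennreal_plus)
    then have split: "(a + ennreal (e / 2)) + (b + ennreal (e / 2)) = (a + b) + ennreal e" for a b
      by (metis add.assoc add.left_commute)
    have "ennreal c * (\<integral>\<^sup>+x. v x + u x \<partial>M) * emeasure M A
        = ennreal c * integral\<^sup>N M v * emeasure M A + ennreal c * integral\<^sup>N M u * emeasure M A"
      by (simp add: nn_integral_add distrib_left distrib_right)
    moreover have "(\<integral>\<^sup>+x. (v x + u x) * indicator ((T ^^ n) -` A \<inter> space M) x \<partial>M)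
        = (\<integral>\<^sup>+x. v x * indicator ((T ^^ n) -` A \<inter> space M) x \<partial>M)
        + (\<integral>\<^sup>+x. u x * indicator ((T ^^ n) -` A \<inter> space M) x \<partial>M)"
      by (simp add: distrib_right nn_integral_add)
    ultimately show "ennreal c * (\<integral>\<^sup>+x. v x + u x \<partial>M) * emeasure M A
        \<le> (\<integral>\<^sup>+x. (v x + u x) * indicator ((T ^^ n) -` A \<inter> space M) x \<partial>M) + ennreal e"
      using add_mono[OF N(2)[of n A] N(1)[of n A]] n A
      by (simp only: split)
  qed
next
  case (seq U)
  have [measurable]: "\<And>i. U i \<in> borel_measurable M" by fact
  have lim: "integral\<^sup>N M (SUP i. U i) = (SUP i. integral\<^sup>N M (U i))"
  proof -
    have "(SUP i. U i) = (\<lambda>x. SUP i. U i x)" by (auto simp: fun_eq_iff image_comp)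
    then show ?thesis using nn_integral_monotone_convergence_SUP[OF seq(4), of M] by simp
  qed
  have fin: "integral\<^sup>N M (SUP i. U i) < \<infinity>" by (fact seq(6))
  \<comment> \<open>This level misses at most \<open>e / 2\<close> of the mass; the other half of
    \<open>e\<close> pays for the bound at that level. A zero total is treated apart, since
    subtracting \<open>e / 2\<close> lowers the total strictly only if it is positive.\<close>
  obtain i where i: "integral\<^sup>N M (SUP i. U i) \<le> integral\<^sup>N M (U i) + ennreal (e / 2)"
  proof (cases "integral\<^sup>N M (SUP i. U i) = 0")
    case True
    then show ?thesis using that by simp
  next
    case False
    have "integral\<^sup>N M (SUP i. U i) - ennreal (e/2) < integral\<^sup>N M (SUP i. U i)"
      using seq(7) fin False by (intro ennreal_between) (auto simp: zero_less_iff_neq_zero)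
    then obtain i where "integral\<^sup>N M (SUP i. U i) - ennreal (e/2) < integral\<^sup>N M (U i)"
      unfolding lim less_SUP_iff by blast
    then have "integral\<^sup>N M (SUP i. U i) \<le> integral\<^sup>N M (U i) + ennreal (e / 2)"
      by (metis add.commute ennreal_minus_le_iff less_imp_le)
    then show ?thesis by (rule that)
  qed
  have "integral\<^sup>N M (U i) < \<infinity>"
    using fin unfolding lim by (meson SUP_upper UNIV_I le_less_trans)
  moreover have e2: "0 < e / 2" using seq(7) by simp
  ultimately obtain N where N: "\<And>n A. n \<ge> N \<Longrightarrow> A \<in> sets M \<Longrightarrow>
      ennreal c * integral\<^sup>N M (U i) * emeasure M A
      \<le> (\<integral>\<^sup>+x. U i x * indicator ((T ^^ n) -` A \<inter> space M) x \<partial>M) + ennreal (e / 2)"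
    using seq(3)[OF _ e2] by blast
  show ?case
  proof (intro exI allI impI ballI)
    fix n A assume n: "n \<ge> N" and A [measurable]: "A \<in> sets M"
    have cA: "ennreal c * emeasure M A \<le> 1"
      using c_pos c_le_1 by (simp add: emeasure_eq_measure ennreal_mult[symmetric] mult_le_one)
    have "ennreal c * integral\<^sup>N M (SUP i. U i) * emeasure M A
        \<le> ennreal c * (integral\<^sup>N M (U i) + ennreal (e / 2)) * emeasure M A"
      by (intro mult_right_mono mult_left_mono i) auto
    also have "\<dots> = ennreal c * integral\<^sup>N M (U i) * emeasure M A
        + (ennreal c * emeasure M A) * ennreal (e / 2)"
      by (simp add: algebra_simps)
    also have "\<dots> \<le> ((\<integral>\<^sup>+x. U i x * indicator ((T ^^ n) -` A \<inter> space M) x \<partial>M)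
        + ennreal (e / 2)) + 1 * ennreal (e / 2)"
      by (intro add_mono N n A mult_right_mono cA) auto
    also have "\<dots> = (\<integral>\<^sup>+x. U i x * indicator ((T ^^ n) -` A \<inter> space M) x \<partial>M) + ennreal e"
      using seq(7) by (simp add: add.assoc ennreal_plus[symmetric] del: ennreal_plus)
    also have "\<dots> \<le> (\<integral>\<^sup>+x. (SUP i. U i) x * indicator ((T ^^ n) -` A \<inter> space M) x \<partial>M) + ennreal e"
      by (intro add_mono nn_integral_mono mult_right_mono) (auto intro: SUP_upper)
    finally show "ennreal c * integral\<^sup>N M (SUP i. U i) * emeasure M A
        \<le> (\<integral>\<^sup>+x. (SUP i. U i) x * indicator ((T ^^ n) -` A \<inter> space M) x \<partial>M) + ennreal e" .
  qed
qed

lemma lower_bound_density: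
  assumes u [measurable]: "u \<in> borel_measurable M" and "integral\<^sup>N M u < \<infinity>" and "0 < e"
  shows "\<exists>N. \<forall>n\<ge>N. \<forall>A\<in>sets M.
    c * measure (density M u) (space M) * measure M A
      \<le> measure (density M u) ((T ^^ n) -` A \<inter> space M) + e"
proof -
  interpret D: finite_measure "density M u"
    using assms by (intro finite_measureI) (auto simp: emeasure_density cong: nn_integral_cong)
  obtain N where N: "\<And>n A. n \<ge> N \<Longrightarrow> A \<in> sets M \<Longrightarrow>
      ennreal c * integral\<^sup>N M u * emeasure M A
      \<le> (\<integral>\<^sup>+x. u x * indicator ((T ^^ n) -` A \<inter> space M) x \<partial>M) + ennreal e"
    using lower_bound_nn_integral[OF assms] by blast
  show ?thesis
  proof (intro exI allI impI ballI)
    fix n A assume n: "n \<ge> N" and A [measurable]: "A \<in> sets M"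
    have "ennreal (measure (density M u) (space M)) = integral\<^sup>N M u"
      by (simp add: D.emeasure_eq_measure[symmetric] emeasure_density cong: nn_integral_cong)
    moreover have "ennreal (measure (density M u) ((T ^^ n) -` A \<inter> space M))
        = (\<integral>\<^sup>+x. u x * indicator ((T ^^ n) -` A \<inter> space M) x \<partial>M)"
      by (simp add: D.emeasure_eq_measure[symmetric] emeasure_density)
    ultimately have "ennreal (c * measure (density M u) (space M) * measure M A)
      \<le> ennreal (measure (density M u) ((T ^^ n) -` A \<inter> space M) + e)"
      using N[OF n A] c_pos assms(3)
      by (simp add: ennreal_mult emeasure_eq_measure)
    then show "c * measure (density M u) (space M) * measure M A
      \<le> measure (density M u) ((T ^^ n) -` A \<inter> space M) + e"
      using assms(3) by (subst (asm) ennreal_le_iff) auto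
  qed
qed

lemma contraction_density:
  assumes u [measurable]: "u \<in> borel_measurable M" and v [measurable]: "v \<in> borel_measurable M"
    and fin: "integral\<^sup>N M u < \<infinity>" and same: "integral\<^sup>N M u = integral\<^sup>N M v"
    and diff: "\<And>A. A \<in> sets M \<Longrightarrow> measure (density M u) A \<le> measure (density M v) A + r"
    and e: "0 < e"
  shows "\<exists>N. \<forall>n\<ge>N. \<forall>A\<in>sets M. measure (density M u) ((T ^^ n) -` A \<inter> space M)
    \<le> measure (density M v) ((T ^^ n) -` A \<inter> space M) + ((1 - c) * r + e)"
proof -
  \<comment> \<open>Remove the common part of \<open>u\<close> and \<open>v\<close>: the lower bound applied to the two remainders,
    which have equal mass, makes a proportion \<open>c\<close> of them cancel.\<close>
  define a b where "a x = (if v x < u x then u x - v x else 0)"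
    and "b x = (if u x < v x then v x - u x else 0)" for x
  have [measurable]: "a \<in> borel_measurable M" "b \<in> borel_measurable M"
    unfolding a_def [abs_def] b_def [abs_def] by measurable
  have ab: "u x + b x = v x + a x" for x
    by (auto simp: a_def b_def add_diff_self_ennreal)
  have fin_v: "integral\<^sup>N M v < \<infinity>" using fin same by simp
  have fin_a: "integral\<^sup>N M a < \<infinity>"
    using fin by (rule le_less_trans[rotated]) (auto simp: a_def intro!: nn_integral_mono diff_le_self_ennreal)
  have fin_b: "integral\<^sup>N M b < \<infinity>"
    using fin_v by (rule le_less_trans[rotated]) (auto simp: b_def intro!: nn_integral_mono diff_le_self_ennreal)
  have fm: "finite_measure (density M f)" if "f \<in> borel_measurable M" "integral\<^sup>N M f < \<infinity>" for f
    using that by (intro finite_measureI) (auto simp: emeasure_density cong: nn_integral_cong)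
  interpret U: finite_measure "density M u" using fm[OF u fin] .
  interpret V: finite_measure "density M v" using fm[OF v fin_v] .
  interpret A: finite_measure "density M a" using fm fin_a by simp
  interpret B: finite_measure "density M b" using fm fin_b by simp
  have balance: "measure (density M u) X + measure (density M b) X
      = measure (density M v) X + measure (density M a) X" if [measurable]: "X \<in> sets M" for X
  proof -
    have "emeasure (density M u) X + emeasure (density M b) X
        = (\<integral>\<^sup>+x. (u x + b x) * indicator X x \<partial>M)"
      by (simp add: emeasure_density nn_integral_add distrib_right)
    also have "\<dots> = emeasure (density M v) X + emeasure (density M a) X"
      by (simp add: ab emeasure_density nn_integral_add distrib_right)
    finally show ?thesis
      by (simp add: U.emeasure_eq_measure V.emeasure_eq_measure A.emeasure_eq_measure
          B.emeasure_eq_measure ennreal_plus[symmetric] del: ennreal_plus)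
  qed
  define d where "d = measure (density M a) (space M)"
  have "emeasure (density M u) (space M) = emeasure (density M v) (space M)"
    using same by (simp add: emeasure_density cong: nn_integral_cong)
  then have d_b: "d = measure (density M b) (space M)"
    using balance[of "space M"] by (simp add: d_def measure_def)
  have "d \<le> r"
  proof -
    \<comment> \<open>A Hahn set for the difference: \<open>b\<close> vanishes on it and
      \<open>a\<close> vanishes off it, so the whole excess \<open>d\<close> is the difference of
      the two measures on \<open>Y\<close>, which \<open>diff\<close> bounds by
      \<open>r\<close>.\<close>
    define Y where "Y = {x \<in> space M. v x \<le> u x}"
    have [measurable]: "Y \<in> sets M" unfolding Y_def by measurable
    have "emeasure (density M b) Y = (\<integral>\<^sup>+x. 0 \<partial>M)"
      unfolding emeasure_density[OF \<open>b \<in> borel_measurable M\<close> \<open>Y \<in> sets M\<close>]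
      by (intro nn_integral_cong) (auto simp: b_def Y_def split: split_indicator)
    then have "measure (density M b) Y = 0" by (simp add: measure_def)
    moreover have "emeasure (density M a) Y = emeasure (density M a) (space M)"
    proof -
      have "(\<integral>\<^sup>+x. a x * indicator Y x \<partial>M) = (\<integral>\<^sup>+x. a x * indicator (space M) x \<partial>M)"
        by (intro nn_integral_cong)
           (auto simp: a_def Y_def split: split_indicator)
      then show ?thesis by (simp add: emeasure_density)
    qed
    ultimately show ?thesis
      using balance[of Y] diff[of Y] by (simp add: d_def measure_def)
  qed
  have e2: "0 < e / 2" using e by simp
  obtain N1 where N1: "\<And>n A. n \<ge> N1 \<Longrightarrow> A \<in> sets M \<Longrightarrow>
      c * d * measure M A \<le> measure (density M a) ((T ^^ n) -` A \<inter> space M) + e / 2"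
    using lower_bound_density[OF _ fin_a e2] unfolding d_def by auto
  obtain N2 where N2: "\<And>n A. n \<ge> N2 \<Longrightarrow> A \<in> sets M \<Longrightarrow>
      c * d * measure M A \<le> measure (density M b) ((T ^^ n) -` A \<inter> space M) + e / 2"
    using lower_bound_density[OF _ fin_b e2] unfolding d_b by auto
  show ?thesis
  proof (intro exI allI impI ballI)
    fix n A assume n: "n \<ge> max N1 N2" and [measurable]: "A \<in> sets M"
    let ?X = "(T ^^ n) -` A \<inter> space M"
    \<comment> \<open>A lower bound on the complement of \<open>A\<close> is an upper bound on
      \<open>A\<close>. Used for \<open>a\<close>, next to the lower bound on \<open>A\<close>
      itself for \<open>b\<close>, it makes the terms with the measure of \<open>A\<close> cancel
      and leaves \<open>(1 - c) * d + e\<close>.\<close>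
    have compl: "(T ^^ n) -` (space M - A) \<inter> space M = space M - ?X"
      by (auto intro: funpow_space)
    have "c * d * measure M (space M - A) \<le> measure (density M a) (space M - ?X) + e / 2"
      using N1[of n "space M - A"] n unfolding compl by simp
    then have "c * d * (1 - measure M A) \<le> d - measure (density M a) ?X + e / 2"
      using A.finite_measure_compl[of ?X] prob_compl[of A] by (simp add: d_def)
    moreover have "c * d * measure M A \<le> measure (density M b) ?X + e / 2"
      using N2[of n A] n by simp
    ultimately have "measure (density M a) ?X - measure (density M b) ?X \<le> (1 - c) * d + e"
      by (simp add: algebra_simps)
    also have "\<dots> \<le> (1 - c) * r + e"
      using \<open>d \<le> r\<close> c_le_1 by (intro add_right_mono mult_left_mono) auto
    finally show "measure (density M u) ?X \<le> measure (density M v) ?X + ((1 - c) * r + e)"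
      using balance[of ?X] by simp
  qed
qed

lemma absolutely_continuous_funpow: "absolutely_continuous M (distr M M (T ^^ n))"
proof (induction n)
  case 0
  show ?case by (auto simp: absolutely_continuous_def distr_id[unfolded id_def])
next
  case (Suc n)
  have "emeasure M ((T ^^ Suc n) -` A \<inter> space M) = 0" if A: "A \<in> null_sets M" for A
  proof -
    have [measurable]: "A \<in> sets M" using A by auto
    have "(T ^^ n) -` A \<inter> space M \<in> null_sets M"
      using Suc A by (auto simp: absolutely_continuous_def null_sets_distr_iff)
    then have "T -` ((T ^^ n) -` A \<inter> space M) \<inter> space M \<in> null_sets M"
      using nonsingular by (auto simp: absolutely_continuous_def null_sets_distr_iff)
    moreover have "T -` ((T ^^ n) -` A \<inter> space M) \<inter> space M = (T ^^ Suc n) -` A \<inter> space M"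
      using measurable_space[OF T_measurable] by (auto simp: funpow_swap1)
    ultimately show ?thesis by auto
  qed
  then show ?case
    by (auto simp: absolutely_continuous_def null_sets_def emeasure_distr simp del: funpow.simps)
qed

lemma contraction_measure:
  assumes "finite_measure \<nu>" "finite_measure \<nu>'"
    and sets: "sets \<nu> = sets M" "sets \<nu>' = sets M"
    and ac: "absolutely_continuous M \<nu>" "absolutely_continuous M \<nu>'"
    and same: "measure \<nu> (space M) = measure \<nu>' (space M)"
    and diff: "\<And>A. A \<in> sets M \<Longrightarrow> measure \<nu> A \<le> measure \<nu>' A + r"
    and e: "0 < e"
  shows "\<exists>N. \<forall>n\<ge>N. \<forall>A\<in>sets M. measure \<nu> ((T ^^ n) -` A \<inter> space M)
    \<le> measure \<nu>' ((T ^^ n) -` A \<inter> space M) + ((1 - c) * r + e)"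
proof -
  interpret N: finite_measure \<nu> by fact
  interpret N': finite_measure \<nu>' by fact
  obtain u where u: "u \<in> borel_measurable M" "density M u = \<nu>"
    using Radon_Nikodym[OF ac(1) sets(1)] by blast
  obtain v where v: "v \<in> borel_measurable M" "density M v = \<nu>'"
    using Radon_Nikodym[OF ac(2) sets(2)] by blast
  have total: "integral\<^sup>N M f = emeasure (density M f) (space M)" if "f \<in> borel_measurable M" for f
    using that by (simp add: emeasure_density cong: nn_integral_cong)
  show ?thesis
    using contraction_density[OF u(1) v(1) _ _ _ e, of r] diff same
    by (simp add: total u v N.emeasure_eq_measure N'.emeasure_eq_measure)
qed

text \<open>Each round restarts from the images at the time reached so far, which are again
  absolutely continuous and of equal mass. The error allowed in a round is \<open>c / 2\<close>
  times the current bound, so the factor is (1 - c) + c/2 = 1 - c/2. The summand 1 in the initial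
  bound keeps this error positive even for the zero measure.\<close>

lemma contraction_iterate:
  assumes fin: "finite_measure \<nu>" "finite_measure \<nu>'"
    and sets: "sets \<nu> = sets M" "sets \<nu>' = sets M"
    and ac: "absolutely_continuous M \<nu>" "absolutely_continuous M \<nu>'"
    and same: "measure \<nu> (space M) = measure \<nu>' (space M)"
  shows "\<exists>N. \<forall>n\<ge>N. \<forall>A\<in>sets M. measure \<nu> ((T ^^ n) -` A \<inter> space M)
    \<le> measure \<nu>' ((T ^^ n) -` A \<inter> space M) + (1 - c / 2) ^ k * (measure \<nu> (space M) + 1)"
proof (induction k)
  case 0
  interpret N: finite_measure \<nu> by fact
  show ?case
  proof (intro exI allI impI ballI)
    fix n A
    have "measure \<nu> ((T ^^ n) -` A \<inter> space M) \<le> measure \<nu> (space M)"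
      using N.bounded_measure sets_eq_imp_space_eq[OF sets(1)] by simp
    then show "measure \<nu> ((T ^^ n) -` A \<inter> space M) \<le> measure \<nu>' ((T ^^ n) -` A \<inter> space M)
        + (1 - c / 2) ^ 0 * (measure \<nu> (space M) + 1)"
      using measure_nonneg[of \<nu>' "(T ^^ n) -` A \<inter> space M"]
      unfolding power_0 mult_1 by linarith
  qed
next
  case (Suc k)
  let ?r = "(1 - c / 2) ^ k * (measure \<nu> (space M) + 1)"
  obtain N where N: "\<And>A. A \<in> sets M \<Longrightarrow> measure \<nu> ((T ^^ N) -` A \<inter> space M)
    \<le> measure \<nu>' ((T ^^ N) -` A \<inter> space M) + ?r" using Suc by blast
  have meas: "T ^^ n \<in> measurable \<nu> M" "T ^^ n \<in> measurable \<nu>' M" for n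
    using funpow_measurable[of n] sets by (auto cong: measurable_cong_sets)
  have space: "space \<nu> = space M" "space \<nu>' = space M"
    using sets by (auto dest: sets_eq_imp_space_eq)
  define \<alpha> \<beta> where "\<alpha> = distr \<nu> M (T ^^ N)" and "\<beta> = distr \<nu>' M (T ^^ N)"
  have \<alpha>: "measure \<alpha> A = measure \<nu> ((T ^^ N) -` A \<inter> space M)"
    and \<beta>: "measure \<beta> A = measure \<nu>' ((T ^^ N) -` A \<inter> space M)" if "A \<in> sets M" for A
    using that meas by (auto simp: \<alpha>_def \<beta>_def measure_distr space)
  have null: "(T ^^ N) -` A \<inter> space M \<in> null_sets M" if "A \<in> null_sets M" for A
    using absolutely_continuous_funpow[of N] that
    by (auto simp: absolutely_continuous_def null_sets_distr_iff)
  have pushforward: "absolutely_continuous M (distr \<kappa> M (T ^^ N))"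
    if \<kappa>: "absolutely_continuous M \<kappa>" "sets \<kappa> = sets M" for \<kappa>
    unfolding absolutely_continuous_def
  proof
    fix X assume X: "X \<in> null_sets M"
    have "T ^^ N \<in> measurable \<kappa> M"
      using funpow_measurable[of N] \<kappa>(2) by (auto cong: measurable_cong_sets)
    moreover have "(T ^^ N) -` X \<inter> space M \<in> null_sets \<kappa>"
      using null[OF X] \<kappa>(1) by (auto simp: absolutely_continuous_def)
    ultimately show "X \<in> null_sets (distr \<kappa> M (T ^^ N))"
      using X sets_eq_imp_space_eq[OF \<kappa>(2)] by (simp add: null_sets_distr_iff null_setsD2)
  qed
  have "0 < 1 - c / 2" "0 < measure \<nu> (space M) + 1"
    using c_le_1 by (auto intro: add_nonneg_pos)
  then have pos: "0 < c / 2 * ?r" using c_pos by simp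
  have whole: "(T ^^ N) -` space M \<inter> space M = space M"
    by (auto intro: funpow_space)
  have "\<exists>N'. \<forall>n\<ge>N'. \<forall>A\<in>sets M. measure \<alpha> ((T ^^ n) -` A \<inter> space M)
    \<le> measure \<beta> ((T ^^ n) -` A \<inter> space M) + ((1 - c) * ?r + c / 2 * ?r)"
  proof (rule contraction_measure)
    show "finite_measure \<alpha>" "finite_measure \<beta>"
      unfolding \<alpha>_def \<beta>_def using fin meas by (auto intro: finite_measure.finite_measure_distr)
    show "sets \<alpha> = sets M" "sets \<beta> = sets M" by (auto simp: \<alpha>_def \<beta>_def)
    show "absolutely_continuous M \<alpha>" "absolutely_continuous M \<beta>"
      unfolding \<alpha>_def \<beta>_def using ac sets by (auto intro: pushforward)
    show "measure \<alpha> (space M) = measure \<beta> (space M)"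
      using same by (simp add: \<alpha> \<beta> whole)
    show "measure \<alpha> A \<le> measure \<beta> A + ?r" if "A \<in> sets M" for A
      using N that by (simp add: \<alpha> \<beta>)
  qed (rule pos)
  then obtain N' where N': "\<And>n A. n \<ge> N' \<Longrightarrow> A \<in> sets M \<Longrightarrow> measure \<alpha> ((T ^^ n) -` A \<inter> space M)
    \<le> measure \<beta> ((T ^^ n) -` A \<inter> space M) + ((1 - c) * ?r + c / 2 * ?r)" by blast
  show ?case
  proof (intro exI allI impI ballI)
    fix n A assume n: "n \<ge> N' + N" and [measurable]: "A \<in> sets M"
    have eq: "(T ^^ N) -` ((T ^^ (n - N)) -` A \<inter> space M) \<inter> space M = (T ^^ n) -` A \<inter> space M"
    proof -
      have "(T ^^ (n - N)) ((T ^^ N) x) = (T ^^ n) x" for x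
        using n funpow_add[of "n - N" N T] by (simp add: fun_eq_iff)
      then show ?thesis by (auto intro: funpow_space)
    qed
    have r: "(1 - c) * ?r + c / 2 * ?r = (1 - c / 2) ^ Suc k * (measure \<nu> (space M) + 1)"
      by (simp add: algebra_simps)
    show "measure \<nu> ((T ^^ n) -` A \<inter> space M) \<le> measure \<nu>' ((T ^^ n) -` A \<inter> space M)
      + (1 - c / 2) ^ Suc k * (measure \<nu> (space M) + 1)"
    proof -
      have m: "(T ^^ (n - N)) -` A \<inter> space M \<in> sets M" by measurable
      have "N' \<le> n - N" using n by simp
      from N'[OF this \<open>A \<in> sets M\<close>] show ?thesis
        by (simp only: \<alpha>[OF m] \<beta>[OF m] eq r)
    qed
  qed
qed

text \<open>The iterated estimate is one-sided; exchanging the two measures gives the absolute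
  value. The number of rounds \<open>k\<close> is fixed first, by \<open>e\<close> and the common
  mass, and only then the times.\<close>

theorem asymptotically_equal:
  assumes fin: "finite_measure \<nu>" "finite_measure \<nu>'"
    and sets: "sets \<nu> = sets M" "sets \<nu>' = sets M"
    and ac: "absolutely_continuous M \<nu>" "absolutely_continuous M \<nu>'"
    and same: "measure \<nu> (space M) = measure \<nu>' (space M)"
    and A: "A \<in> sets M"
  shows "(\<lambda>n. measure \<nu> ((T ^^ n) -` A \<inter> space M) - measure \<nu>' ((T ^^ n) -` A \<inter> space M))
    \<longlonglongrightarrow> 0"
proof (rule LIMSEQ_I)
  fix e :: real assume "0 < e"
  let ?m = "measure \<nu> (space M) + 1"
  have m: "0 < ?m" by (auto intro: add_nonneg_pos)
  have "(\<lambda>k. (1 - c / 2) ^ k * ?m) \<longlonglongrightarrow> 0 * ?m"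
    using c_pos c_le_1 by (intro tendsto_mult LIMSEQ_power_zero tendsto_const) auto
  then have "\<forall>\<^sub>F k in sequentially. (1 - c / 2) ^ k * ?m < e"
    using \<open>0 < e\<close> by (intro order_tendstoD(2)[of _ 0]) auto
  then obtain k where k: "(1 - c / 2) ^ k * ?m < e"
    by (auto simp: eventually_sequentially)
  obtain N1 where N1: "\<And>n. n \<ge> N1 \<Longrightarrow> measure \<nu> ((T ^^ n) -` A \<inter> space M)
      \<le> measure \<nu>' ((T ^^ n) -` A \<inter> space M) + (1 - c / 2) ^ k * ?m"
    using contraction_iterate[OF fin sets ac same, of k] A by blast
  obtain N2 where N2: "\<And>n. n \<ge> N2 \<Longrightarrow> measure \<nu>' ((T ^^ n) -` A \<inter> space M)
      \<le> measure \<nu> ((T ^^ n) -` A \<inter> space M) + (1 - c / 2) ^ k * ?m"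
    using contraction_iterate[OF fin(2,1) sets(2,1) ac(2,1) same[symmetric], of k] A
    unfolding same by blast
  show "\<exists>N. \<forall>n\<ge>N. norm (measure \<nu> ((T ^^ n) -` A \<inter> space M)
      - measure \<nu>' ((T ^^ n) -` A \<inter> space M) - 0) < e"
  proof (intro exI allI impI)
    fix n assume "n \<ge> max N1 N2"
    then show "norm (measure \<nu> ((T ^^ n) -` A \<inter> space M)
      - measure \<nu>' ((T ^^ n) -` A \<inter> space M) - 0) < e"
      using N1[of n] N2[of n] k by (auto simp: abs_less_iff)
  qed
qed
end

section \<open>The densities of the inverse branches\<close>

definition fibre_map :: "bool \<Rightarrow> real \<Rightarrow> real" where
  "fibre_map b = (if b then renyi_map else gauss_map)"

text \<open>Branches are numbered from 1; the digit 0 arises only from \<open>1 / 0 = 0\<close> at the singular point.\<close>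

definition digit :: "bool \<Rightarrow> real \<Rightarrow> nat" where
  "digit b x = nat \<lfloor>1 / (if b then 1 - x else x)\<rfloor>"

lemma fibre_map_measurable [measurable]: "fibre_map b \<in> borel_measurable borel"
proof -
  have "gauss_map \<in> borel_measurable borel" "renyi_map \<in> borel_measurable borel"
    unfolding gauss_map_def [abs_def] renyi_map_def [abs_def] frac_def by measurable
  then show ?thesis by (simp add: fibre_map_def)
qed

lemma digit_measurable [measurable]: "digit b \<in> measurable borel (count_space UNIV)"
  unfolding digit_def [abs_def] by measurable

text \<open>The reflection x -> 1 - x turns the Renyi map into the Gauss map, so facts about single
  branches are proved for one map and carried over.\<close>

lemma fibre_map_True: "fibre_map True x = fibre_map False (1 - x)"
  by (simp add: fibre_map_def renyi_map_def gauss_map_def)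

lemma digit_True: "digit True x = digit False (1 - x)"
  by (simp add: digit_def)

lemma fibre_map_in_unit: "fibre_map b x \<in> {0..1}"
  by (auto simp: fibre_map_def renyi_map_def gauss_map_def less_imp_le[OF frac_lt_1])

text \<open>The endpoint \<open>y = 1\<close> is excluded because 1 / (k + 1) already has digit k +
  1 and image 0.\<close>

lemma digit_False_branch:
  assumes "1 \<le> k" "0 \<le> y" "y < 1"
  shows "digit False (1 / (real k + y)) = k" "fibre_map False (1 / (real k + y)) = y"
proof -
  have "\<lfloor>real k + y\<rfloor> = int k" using assms by (intro floor_unique) auto
  moreover have "real k + y \<noteq> 0" using assms by simp
  ultimately show "digit False (1 / (real k + y)) = k" "fibre_map False (1 / (real k + y)) = y"
    by (auto simp: digit_def fibre_map_def gauss_map_def frac_def)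
qed

lemma digit_False_eqD:
  assumes "digit False x = k" "1 \<le> k"
  shows "x = 1 / (real k + fibre_map False x)" "0 < x" "1 / (real k + 1) \<le> x" "x \<le> 1 / real k"
proof -
  have fl: "\<lfloor>1 / x\<rfloor> = int k" using assms by (auto simp: digit_def)
  then have "0 < 1 / x" using assms by linarith
  then show "0 < x" by (simp add: zero_less_divide_iff)
  then have "fibre_map False x = 1 / x - real k"
    using fl by (simp add: fibre_map_def gauss_map_def frac_def)
  then show "x = 1 / (real k + fibre_map False x)" by simp
  have "real k \<le> 1 / x" "1 / x \<le> real k + 1" using fl by linarith+
  then show "1 / (real k + 1) \<le> x" "x \<le> 1 / real k"
    using \<open>0 < x\<close> assms(2) by (auto simp: field_simps)
qed

lemma digit_eq_0D:
  assumes "digit b x = 0" "x \<in> {0..1}"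
  shows "x = (if b then 1 else 0)"
proof -
  define y where "y = (if b then 1 - x else x)"
  have y: "0 \<le> y" "y \<le> 1" using assms(2) by (auto simp: y_def)
  have "y = 0"
  proof (rule ccontr)
    assume "y \<noteq> 0"
    then have "1 \<le> 1 / y" using y by simp
    then have "1 \<le> \<lfloor>1 / y\<rfloor>" by simp
    then show False using assms(1) by (auto simp: digit_def y_def)
  qed
  then show ?thesis by (auto simp: y_def split: if_splits)
qed

text \<open>Substitution of u = 1 - 1 / (k + y), the inverse of Renyi branch k. This branch is
  increasing, with derivative 1 / (k + y)^2, so the rule for nondecreasing substitutions applies;
  the decreasing Gauss branch is reached later by reflection.\<close>

lemma nn_integral_branch:
  assumes k: "1 \<le> k" and [measurable]: "w \<in> borel_measurable borel" "B \<in> sets borel"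
  shows "(\<integral>\<^sup>+u. indicator {u. digit True u = k \<and> fibre_map True u \<in> B} u * w u \<partial>lborel)
    = (\<integral>\<^sup>+y. indicator (B \<inter> {0..1}) y * (w (1 - 1 / (real k + y)) * ennreal (1 / (real k + y)\<^sup>2)) \<partial>lborel)"
proof -
  let ?g = "\<lambda>y. 1 - 1 / (real k + y)"
  let ?f = "\<lambda>u. indicator {u. digit True u = k \<and> fibre_map True u \<in> B} u * w u"
  have "(\<integral>\<^sup>+u. ?f u \<partial>lborel) = (\<integral>\<^sup>+u. ?f u * indicator {?g 0..?g 1} u \<partial>lborel)"
    using digit_False_eqD(3,4)[OF _ k] by (intro nn_integral_cong)
      (force split: split_indicator simp: digit_True fibre_map_True)
  also have "\<dots> = (\<integral>\<^sup>+y. ?f (?g y) * ennreal (1 / (real k + y)\<^sup>2) * indicator {0..1} y \<partial>lborel)"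
  proof (rule nn_integral_substitution_aux)
    show "(?g has_real_derivative 1 / (real k + y)\<^sup>2) (at y)" if "y \<in> {0..1}" for y
      using that k by (auto intro!: derivative_eq_intros simp: power2_eq_square)
    show "continuous_on {0..1} (\<lambda>y. 1 / (real k + y)\<^sup>2)"
      using k by (intro continuous_intros) auto
  qed (use k in auto)
  also have "\<dots> = (\<integral>\<^sup>+y. indicator (B \<inter> {0..1}) y * (w (?g y) * ennreal (1 / (real k + y)\<^sup>2)) \<partial>lborel)"
  proof (rule nn_integral_cong_AE)
    \<comment> \<open>The point \<open>y = 1\<close> belongs to the next branch and is discarded as
      a null set.\<close>
    have "AE y in lborel. y \<noteq> (1::real)" by (rule AE_lborel_singleton)
    then show "AE y in lborel. ?f (?g y) * ennreal (1 / (real k + y)\<^sup>2) * indicator {0..1} y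
      = indicator (B \<inter> {0..1}) y * (w (?g y) * ennreal (1 / (real k + y)\<^sup>2))"
    proof eventually_elim
      case (elim y)
      show ?case
      proof (cases "y \<in> {0..1}")
        case True
        then have "digit True (?g y) = k" "fibre_map True (?g y) = y"
          using digit_False_branch[of k y] k elim by (auto simp: digit_True fibre_map_True)
        with True show ?thesis by (auto split: split_indicator)
      qed simp
    qed
  qed
  finally show ?thesis .
qed

text \<open>The derivative of x -> (1 + t) x / (1 + t x), the Moebius map of the unit interval that
  fixes both endpoints. Since the inverse branches are Moebius maps as well, this family is stable
  under them; t = 0 is Lebesgue measure.\<close>

definition moebius_density :: "real \<Rightarrow> real \<Rightarrow> real" where
  "moebius_density t x = (1 + t) / (1 + t * x)\<^sup>2"

definition moebius_measure :: "real \<Rightarrow> real measure" where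
  "moebius_measure t = density unit_lebesgue (\<lambda>x. ennreal (moebius_density t x))"

lemma moebius_density_measurable [measurable]: "moebius_density t \<in> borel_measurable borel"
  unfolding moebius_density_def [abs_def] by measurable

lemma sets_unit_lebesgue: "sets unit_lebesgue = sets (restrict_space borel {0..1})"
  by (simp add: unit_lebesgue_def sets_restrict_space)

lemma space_unit_lebesgue [simp]: "space unit_lebesgue = {0..1}"
  by (simp add: unit_lebesgue_def space_restrict_space)

lemma sets_unit_lebesgue_iff: "B \<in> sets unit_lebesgue \<longleftrightarrow> B \<in> sets borel \<and> B \<subseteq> {0..1}"
  by (auto simp: unit_lebesgue_def sets_restrict_space_iff)

lemma measurable_unit_lebesgue: "f \<in> measurable borel M \<Longrightarrow> f \<in> measurable unit_lebesgue M"
  by (simp add: measurable_cong_sets[OF sets_unit_lebesgue refl] measurable_restrict_space1)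

lemma sets_moebius_measure [simp]: "sets (moebius_measure t) = sets unit_lebesgue"
  and space_moebius_measure [simp]: "space (moebius_measure t) = {0..1}"
  by (auto simp: moebius_measure_def)

lemma emeasure_moebius_measure:
  assumes "B \<in> sets unit_lebesgue"
  shows "emeasure (moebius_measure t) B = (\<integral>\<^sup>+x. indicator B x * ennreal (moebius_density t x) \<partial>lborel)"
proof -
  have "emeasure (moebius_measure t) B
      = (\<integral>\<^sup>+x. ennreal (moebius_density t x) * indicator B x \<partial>unit_lebesgue)"
    using assms unfolding moebius_measure_def
    by (intro emeasure_density measurable_unit_lebesgue) auto
  also have "\<dots> = (\<integral>\<^sup>+x. ennreal (moebius_density t x) * indicator B x * indicator {0..1} x \<partial>lborel)"
    unfolding unit_lebesgue_def by (subst nn_integral_restrict_space) auto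
  also have "\<dots> = (\<integral>\<^sup>+x. indicator B x * ennreal (moebius_density t x) \<partial>lborel)"
    using assms by (intro nn_integral_cong) (auto simp: sets_unit_lebesgue_iff split: split_indicator)
  finally show ?thesis .
qed

lemma moebius_measure_0: "moebius_measure 0 = unit_lebesgue"
  by (simp add: moebius_measure_def moebius_density_def density_1)

lemma prob_space_moebius_measure:
  assumes "0 \<le> t" shows "prob_space (moebius_measure t)"
proof
  let ?F = "\<lambda>x. (1 + t) * x / (1 + t * x)"
  have "emeasure (moebius_measure t) (space (moebius_measure t))
      = (\<integral>\<^sup>+x. ennreal (moebius_density t x) * indicator {0..1} x \<partial>lborel)"
    by (subst emeasure_moebius_measure) (auto simp: sets_unit_lebesgue_iff mult.commute)
  also have "\<dots> = ennreal (?F 1 - ?F 0)"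
  proof (rule nn_integral_FTC_Icc)
    fix x :: real assume x: "x \<in> {0..1}"
    then have "1 + t * x > 0" using assms by (auto intro: add_pos_nonneg)
    then show "(?F has_real_derivative moebius_density t x) (at x)"
      by (auto intro!: derivative_eq_intros simp: moebius_density_def power2_eq_square algebra_simps)
    show "0 \<le> moebius_density t x" using assms by (simp add: moebius_density_def)
  qed auto
  finally show "emeasure (moebius_measure t) (space (moebius_measure t)) = 1"
    using assms by simp
qed

text \<open>The density decreases on the unit interval, and its value 1 / (1 + t) at the right
  endpoint is at least 1/2 exactly because \<open>t \<le> 1\<close>.\<close>

lemma moebius_measure_lower:
  assumes "0 \<le> t" "t \<le> 1" "B \<in> sets unit_lebesgue"
  shows "ennreal (1 / 2) * emeasure unit_lebesgue B \<le> emeasure (moebius_measure t) B"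
proof -
  have half: "1 / 2 \<le> moebius_density t x" if "x \<in> {0..1}" for x
  proof -
    have "1 + t * x \<le> 1 + t" "0 < 1 + t * x"
      using that assms by (auto intro: mult_left_le add_pos_nonneg)
    then have "(1 + t * x)\<^sup>2 \<le> (1 + t)\<^sup>2" by (intro power_mono) auto
    also have "\<dots> \<le> (1 + t) * 2" unfolding power2_eq_square using assms by (intro mult_left_mono) auto
    finally show ?thesis using \<open>0 < 1 + t * x\<close> by (simp add: moebius_density_def field_simps)
  qed
  have "(\<integral>\<^sup>+x. ennreal (1 / 2) * (indicator B x * ennreal (moebius_density 0 x)) \<partial>lborel)
      \<le> (\<integral>\<^sup>+x. indicator B x * ennreal (moebius_density t x) \<partial>lborel)"
  proof (intro nn_integral_mono)
    fix x
    have "moebius_density 0 x = 1" by (simp add: moebius_density_def)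
    moreover have "ennreal (1 / 2) \<le> ennreal (moebius_density t x)" if "x \<in> B"
      using half[of x] that assms(3) by (intro ennreal_leI) (auto simp: sets_unit_lebesgue_iff)
    ultimately show "ennreal (1 / 2) * (indicator B x * ennreal (moebius_density 0 x))
        \<le> indicator B x * ennreal (moebius_density t x)"
      by (cases "x \<in> B") auto
  qed
  moreover have [measurable]: "B \<in> sets borel" using assms(3) by (simp add: sets_unit_lebesgue_iff)
  ultimately show ?thesis
    unfolding moebius_measure_0[symmetric] emeasure_moebius_measure[OF assms(3)]
    by (subst (asm) nn_integral_cmult) auto
qed

text \<open>\<open>branch_param b k t\<close> is the parameter of the image of \<open>g\<^sub>t\<close> under branch \<open>k\<close> of the Gauss
  (\<open>b = False\<close>) or Renyi (\<open>b = True\<close>) map.\<close>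

definition branch_param :: "bool \<Rightarrow> nat \<Rightarrow> real \<Rightarrow> real" where
  "branch_param b k t = (if b then (1 + t) / ((1 + t) * real k - t) else 1 / (real k + t))"

lemma branch_param_nonneg:
  assumes k: "1 \<le> k" and t: "0 \<le> t"
  shows "0 \<le> branch_param b k t"
proof -
  have "(1 + t) * 1 \<le> (1 + t) * real k" using k t by (intro mult_left_mono) auto
  then have "t \<le> (1 + t) * real k" by simp
  then show ?thesis using t by (auto simp: branch_param_def intro!: divide_nonneg_nonneg)
qed

lemma branch_param_False_le_1: "1 \<le> k \<Longrightarrow> 0 \<le> t \<Longrightarrow> branch_param False k t \<le> 1"
  by (auto simp: branch_param_def)

text \<open>Along a branch, 1 + t u becomes a linear form in y divided by k + y, and the denominator
  cancels against the Jacobian. The linear form has value \<open>s\<close> at y = 0; dividing by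
  \<open>s\<close> brings it to the shape 1 + t' y and so reveals the new parameter t'. The witness
  is what remains, and it equals the mass that g_t gives to the branch.\<close>

lemma moebius_density_branch:
  assumes "1 \<le> k" "0 \<le> t"
  shows "\<exists>c\<ge>0. \<forall>y\<in>{0..1}.
    moebius_density t (if b then 1 - 1 / (real k + y) else 1 / (real k + y)) * (1 / (real k + y)\<^sup>2)
      = c * moebius_density (branch_param b k t) y"
proof (cases b)
  case True
  define s where "s = (1 + t) * real k - t"
  have "(1 + t) * 1 \<le> (1 + t) * real k" using assms by (intro mult_left_mono) auto
  then have s: "1 \<le> s" by (simp add: s_def)
  show ?thesis
  proof (intro exI[of _ "(1 + t) / (s * (s + (1 + t)))"] conjI ballI)
    show "0 \<le> (1 + t) / (s * (s + (1 + t)))" using s assms by auto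
    fix y :: real assume y: "y \<in> {0..1}"
    have ky: "0 < real k + y" using assms y by auto
    have sy: "0 < s + (1 + t) * y" using s assms y by (intro add_pos_nonneg mult_nonneg_nonneg) auto
    have "1 + t * (1 - 1 / (real k + y)) = (s + (1 + t) * y) / (real k + y)"
      using ky by (simp add: s_def field_simps)
    moreover have "1 + (1 + t) / s * y = (s + (1 + t) * y) / s"
      using s by (simp add: field_simps)
    moreover have "1 + (1 + t) / s = (s + (1 + t)) / s" using s by (simp add: field_simps)
    ultimately show "moebius_density t (if b then 1 - 1 / (real k + y) else 1 / (real k + y))
        * (1 / (real k + y)\<^sup>2) = (1 + t) / (s * (s + (1 + t))) * moebius_density (branch_param b k t) y"
      using True ky sy s assms(2)
      by (simp add: moebius_density_def branch_param_def s_def[symmetric])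
         (simp add: power2_eq_square divide_simps)
  qed
next
  case False
  define s where "s = real k + t"
  have s: "1 \<le> s" using assms by (simp add: s_def)
  show ?thesis
  proof (intro exI[of _ "(1 + t) / (s * (s + 1))"] conjI ballI)
    show "0 \<le> (1 + t) / (s * (s + 1))" using s assms by auto
    fix y :: real assume y: "y \<in> {0..1}"
    have ky: "0 < real k + y" using assms y by auto
    have sy: "0 < s + y" using s assms y by (intro add_pos_nonneg) auto
    have "1 + t * (1 / (real k + y)) = (s + y) / (real k + y)"
      using ky by (simp add: s_def field_simps)
    moreover have "1 + 1 / s * y = (s + y) / s"
      using s by (simp add: field_simps)
    moreover have "1 + 1 / s = (s + 1) / s" using s by (simp add: field_simps)
    ultimately show "moebius_density t (if b then 1 - 1 / (real k + y) else 1 / (real k + y))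
        * (1 / (real k + y)\<^sup>2) = (1 + t) / (s * (s + 1)) * moebius_density (branch_param b k t) y"
      using False ky sy s assms(2)
      by (simp add: moebius_density_def branch_param_def s_def[symmetric])
         (simp add: power2_eq_square divide_simps)
  qed
qed

text \<open>One substitution serves both maps: a Gauss branch is a Renyi branch seen through u -> 1
  - u, and the weight \<open>?w\<close> absorbs this reflection. The factor is the same for all
  \<open>B\<close>, which later allows it to be identified from the whole space.\<close>

lemma moebius_measure_branch:
  assumes k: "1 \<le> k" and t: "0 \<le> t"
  shows "\<exists>c. \<forall>B\<in>sets unit_lebesgue.
    emeasure (moebius_measure t) {x \<in> {0..1}. digit b x = k \<and> fibre_map b x \<in> B}
      = c * emeasure (moebius_measure (branch_param b k t)) B"
proof -
  obtain c where c: "0 \<le> c" "\<And>y. y \<in> {0..1} \<Longrightarrow>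
      moebius_density t (if b then 1 - 1 / (real k + y) else 1 / (real k + y)) * (1 / (real k + y)\<^sup>2)
      = c * moebius_density (branch_param b k t) y"
    using moebius_density_branch[OF k t] by metis
  have "emeasure (moebius_measure t) {x \<in> {0..1}. digit b x = k \<and> fibre_map b x \<in> B}
      = ennreal c * emeasure (moebius_measure (branch_param b k t)) B"
    if B: "B \<in> sets unit_lebesgue" for B
  proof -
    have [measurable]: "B \<in> sets borel" and B01: "B \<inter> {0..1} = B"
      using B by (auto simp: sets_unit_lebesgue_iff)
    let ?S = "\<lambda>b. {x. digit b x = k \<and> fibre_map b x \<in> B}"
    let ?w = "\<lambda>u. ennreal (moebius_density t (if b then u else 1 - u))"
    have unit: "x \<in> {0..1}" if "digit b x = k" for x
    proof -
      have k1: "1 / real k \<le> 1" using k by simp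
      show ?thesis
      proof (cases b)
        case True
        then have "digit False (1 - x) = k" using that by (simp add: digit_True)
        from digit_False_eqD(2,4)[OF this k] k1 show ?thesis by (simp del: of_nat_le_iff)
      next
        case False
        then have "digit False x = k" using that by simp
        from digit_False_eqD(2,4)[OF this k] k1 show ?thesis by (auto intro: order.trans)
      qed
    qed
    then have "{x \<in> {0..1}. digit b x = k \<and> fibre_map b x \<in> B} = ?S b" by auto
    moreover have [measurable]: "?S b \<in> sets borel" for b by measurable
    ultimately have "emeasure (moebius_measure t) {x \<in> {0..1}. digit b x = k \<and> fibre_map b x \<in> B}
        = (\<integral>\<^sup>+x. indicator (?S b) x * ennreal (moebius_density t x) \<partial>lborel)"
      using unit by (subst emeasure_moebius_measure) (auto simp: sets_unit_lebesgue_iff)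
    also have "\<dots> = (\<integral>\<^sup>+u. indicator (?S True) u * ?w u \<partial>lborel)"
    proof (cases b)
      case False
      then show ?thesis
        \<comment> \<open>The affine substitution with slope -1 and offset 1 is the
          reflection.\<close>
        using nn_integral_real_affine[of "\<lambda>x. indicator (?S b) x * ennreal (moebius_density t x)" "-1" 1]
        by (simp add: indicator_def digit_True fibre_map_True)
    qed simp
    also have "\<dots> = (\<integral>\<^sup>+y. indicator B y
        * (?w (1 - 1 / (real k + y)) * ennreal (1 / (real k + y)\<^sup>2)) \<partial>lborel)"
      using nn_integral_branch[OF k, of ?w B] by (simp add: B01)
    also have "\<dots> = (\<integral>\<^sup>+y. ennreal c * (indicator B y
        * ennreal (moebius_density (branch_param b k t) y)) \<partial>lborel)"
    proof (rule nn_integral_cong)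
      fix y
      show "indicator B y * (?w (1 - 1 / (real k + y)) * ennreal (1 / (real k + y)\<^sup>2))
        = ennreal c * (indicator B y * ennreal (moebius_density (branch_param b k t) y))"
      proof (cases "y \<in> B")
        case True
        then have y: "y \<in> {0..1}" using B01 by auto
        have nn: "0 \<le> moebius_density t x" for x using t by (simp add: moebius_density_def)
        have "0 \<le> moebius_density (branch_param b k t) y"
          using branch_param_nonneg[OF k t] by (simp add: moebius_density_def)
        then show ?thesis
          using True c(1) c(2)[OF y] nn
          by (simp add: ennreal_mult[symmetric] split: if_splits)
      qed simp
    qed
    also have "\<dots> = ennreal c * emeasure (moebius_measure (branch_param b k t)) B"
      using B by (subst nn_integral_cmult) (auto simp: emeasure_moebius_measure)
    finally show ?thesis .
  qed
  then show ?thesis by blast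
qed

section \<open>The skew product\<close>

definition moebius_product :: "real \<Rightarrow> real \<Rightarrow> (bool stream \<times> real) measure" where
  "moebius_product p t = bernoulli_measure p \<Otimes>\<^sub>M moebius_measure t"

text \<open>The map alone is not enough: only after the branch is fixed as well is the fibre map
  injective on the unit interval.\<close>

definition symbol :: "bool stream \<times> real \<Rightarrow> bool \<times> nat" where
  "symbol z = (shd (fst z), digit (shd (fst z)) (snd z))"

lemma random_cf_map_eq: "random_cf_map z = (stl (fst z), fibre_map (shd (fst z)) (snd z))"
  by (simp add: random_cf_map_def fibre_map_def case_prod_beta)

lemma space_bernoulli_measure [simp]: "space (bernoulli_measure p) = UNIV"
  by (simp add: bernoulli_measure_def space_stream_space)

lemma prob_space_bernoulli_measure: "prob_space (bernoulli_measure p)"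
  unfolding bernoulli_measure_def
  by (intro prob_space.prob_space_stream_space) (rule measure_pmf.prob_space_axioms)

lemma sets_moebius_product: "sets (moebius_product p t) = sets (bernoulli_measure p \<Otimes>\<^sub>M unit_lebesgue)"
  unfolding moebius_product_def by (intro sets_pair_measure_cong) auto

lemma space_moebius_product [simp]: "space (moebius_product p t) = UNIV \<times> {0..1}"
  by (simp add: moebius_product_def space_pair_measure)

lemma prob_space_moebius_product: "0 \<le> t \<Longrightarrow> prob_space (moebius_product p t)"
  unfolding moebius_product_def
  by (intro prob_space_pair prob_space_bernoulli_measure prob_space_moebius_measure)

lemma random_cf_map_measurable_moebius:
  "random_cf_map \<in> measurable (moebius_product p t) (moebius_product p t')"
  using random_cf_map_measurable[of unit_lebesgue p]
  by (simp add: measurable_cong_sets[OF sets_moebius_product sets_moebius_product])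

lemma symbol_measurable: "symbol \<in> measurable (moebius_product p t) (count_space UNIV)"
proof -
  let ?M = "bernoulli_measure p \<Otimes>\<^sub>M moebius_measure t"
  have hd: "(\<lambda>z. shd (fst z)) \<in> measurable ?M (count_space UNIV)"
  proof -
    have "(\<lambda>z. shd (fst z)) \<in> measurable ?M (measure_pmf (bernoulli_pmf (1 - p)))"
      unfolding bernoulli_measure_def by measurable
    then show ?thesis by simp
  qed
  have "digit b \<in> measurable (moebius_measure t) (count_space UNIV)" for b
    using measurable_unit_lebesgue[OF digit_measurable]
    by (simp add: measurable_cong_sets[OF sets_moebius_measure refl])
  then have dg: "(\<lambda>z. digit b (snd z)) \<in> measurable ?M (count_space UNIV)" for b
    by (rule measurable_compose[OF measurable_snd])
  have "(\<lambda>z. (b, digit b (snd z))) \<in> measurable ?M (count_space UNIV)" for b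
    by (rule measurable_compose[OF dg]) simp
  from measurable_compose_countable[OF this hd]
  show ?thesis by (simp add: moebius_product_def symbol_def [abs_def])
qed

lemma symbol_set [measurable]:
  "X \<in> sets (moebius_product p t) \<Longrightarrow> {z \<in> X. symbol z = a} \<in> sets (moebius_product p t)"
proof -
  assume X: "X \<in> sets (moebius_product p t)"
  have "symbol -` {a} \<inter> space (moebius_product p t) \<in> sets (moebius_product p t)"
    by (rule measurable_sets[OF symbol_measurable]) simp
  with X have "X \<inter> (symbol -` {a} \<inter> space (moebius_product p t)) \<in> sets (moebius_product p t)" by blast
  moreover have "X \<inter> (symbol -` {a} \<inter> space (moebius_product p t)) = {z \<in> X. symbol z = a}"
    using sets.sets_into_space[OF X] by auto
  ultimately show ?thesis by simp
qed

text \<open>Almost every slice of a null set is null for \<open>N\<close>, hence for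
  \<open>N'\<close>, and the slices are then integrated back.\<close>

lemma absolutely_continuous_pair_measure:
  assumes "sigma_finite_measure N" "sigma_finite_measure N'" "sets N' = sets N" "absolutely_continuous N N'"
  shows "absolutely_continuous (M \<Otimes>\<^sub>M N) (M \<Otimes>\<^sub>M N')"
  unfolding absolutely_continuous_def
proof
  interpret N: sigma_finite_measure N by fact
  interpret N': sigma_finite_measure N' by fact
  have sets: "sets (M \<Otimes>\<^sub>M N') = sets (M \<Otimes>\<^sub>M N)" by (intro sets_pair_measure_cong assms refl)
  fix A assume "A \<in> null_sets (M \<Otimes>\<^sub>M N)"
  then have A: "A \<in> sets (M \<Otimes>\<^sub>M N)" "A \<in> sets (M \<Otimes>\<^sub>M N')" "emeasure (M \<Otimes>\<^sub>M N) A = 0"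
    using sets by auto
  then have "AE x in M. emeasure N (Pair x -` A) = 0"
    by (simp add: N.emeasure_pair_measure_alt nn_integral_0_iff_AE N.measurable_emeasure_Pair)
  then have "AE x in M. emeasure N' (Pair x -` A) = 0"
  proof eventually_elim
    case (elim x)
    then have "Pair x -` A \<in> null_sets N" using sets_Pair1[OF A(1)] by (auto simp: null_sets_def)
    then show ?case using assms(4) by (auto simp: absolutely_continuous_def)
  qed
  then show "A \<in> null_sets (M \<Otimes>\<^sub>M N')"
    using A by (auto simp: null_sets_def N'.emeasure_pair_measure_alt nn_integral_0_iff_AE
        N'.measurable_emeasure_Pair)
qed

lemma absolutely_continuous_moebius_product:
  assumes "0 \<le> t" shows "absolutely_continuous (moebius_product p 0) (moebius_product p t)"
  unfolding moebius_product_def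
proof (rule absolutely_continuous_pair_measure)
  show "sigma_finite_measure (moebius_measure 0)" "sigma_finite_measure (moebius_measure t)"
    using prob_space_moebius_measure[of 0] prob_space_moebius_measure[OF assms]
    by (simp_all add: prob_space_imp_sigma_finite)
  show "absolutely_continuous (moebius_measure 0) (moebius_measure t)"
    unfolding moebius_measure_0 unfolding moebius_measure_def
    by (intro absolutely_continuousI_density measurable_unit_lebesgue) auto
qed simp

lemma moebius_product_lower:
  assumes "0 \<le> t" "t \<le> 1" and A: "A \<in> sets (moebius_product p 0)"
  shows "ennreal (1 / 2) * emeasure (moebius_product p 0) A \<le> emeasure (moebius_product p t) A"
proof -
  interpret G: prob_space "moebius_measure t" using assms(1) by (rule prob_space_moebius_measure)
  interpret L: prob_space "moebius_measure 0" by (rule prob_space_moebius_measure) simp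
  have A': "A \<in> sets (bernoulli_measure p \<Otimes>\<^sub>M moebius_measure 0)"
    "A \<in> sets (bernoulli_measure p \<Otimes>\<^sub>M moebius_measure t)"
    using A sets_moebius_product by (auto simp: moebius_product_def)
  have "ennreal (1 / 2) * emeasure (moebius_product p 0) A
      = (\<integral>\<^sup>+\<omega>. ennreal (1 / 2) * emeasure (moebius_measure 0) (Pair \<omega> -` A) \<partial>bernoulli_measure p)"
    unfolding moebius_product_def L.emeasure_pair_measure_alt[OF A'(1)]
    by (rule nn_integral_cmult[symmetric]) (rule L.measurable_emeasure_Pair[OF A'(1)])
  also have "\<dots> \<le> (\<integral>\<^sup>+\<omega>. emeasure (moebius_measure t) (Pair \<omega> -` A) \<partial>bernoulli_measure p)"
    using assms(1,2) sets_Pair1[OF A'(1)]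
    unfolding moebius_measure_0 by (intro nn_integral_mono moebius_measure_lower) auto
  also have "\<dots> = emeasure (moebius_product p t) A"
    using A' unfolding moebius_product_def by (simp add: G.emeasure_pair_measure_alt)
  finally show ?thesis .
qed

section \<open>Decomposition by the first symbol\<close>

lemma moebius_product_snd_null:
  assumes "0 \<le> t" shows "emeasure (moebius_product p t) {z \<in> UNIV \<times> {0..1}. snd z = x} = 0"
proof (cases "x \<in> {0..1}")
  case True
  interpret G: prob_space "moebius_measure t" using assms by (rule prob_space_moebius_measure)
  have x: "{x} \<in> sets (moebius_measure t)" using True by (simp add: sets_unit_lebesgue_iff)
  have "emeasure (moebius_measure t) {x} = 0"
  proof -
    have "(\<integral>\<^sup>+y. indicator {x} y * ennreal (moebius_density t y) \<partial>lborel) = (\<integral>\<^sup>+(y::real). 0 \<partial>lborel)"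
    proof (rule nn_integral_cong_AE)
      show "AE y in lborel. indicator {x} y * ennreal (moebius_density t y) = 0"
        using AE_lborel_singleton[of x] by eventually_elim auto
    qed
    then show ?thesis using x by (simp add: emeasure_moebius_measure)
  qed
  moreover have "{z \<in> UNIV \<times> {0..1}. snd z = x} = space (bernoulli_measure p) \<times> {x}"
    using True by auto
  ultimately show ?thesis
    using G.emeasure_pair_measure_Times[OF sets.top x, of "bernoulli_measure p"]
    by (simp only: moebius_product_def mult_zero_right)
next
  case False
  then have "{z \<in> UNIV \<times> {0..1}. snd z = x} = ({} :: (bool stream \<times> real) set)" by auto
  then show ?thesis by (simp only: emeasure_empty)
qed

text \<open>Digit 0 occurs only at the singular point of the fibre map, that is, on a strip over a
  single point. Sums over symbols therefore see only the branches with k >= 1.\<close>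

lemma symbol_0_null:
  assumes "0 \<le> t" and X: "X \<in> sets (moebius_product p t)"
  shows "emeasure (moebius_product p t) {z \<in> X. symbol z = (b, 0)} = 0"
proof -
  let ?x = "if b then 1 else 0 :: real"
  have "{?x} \<in> sets (moebius_measure t)" by (simp add: sets_unit_lebesgue_iff)
  from measurable_sets[OF measurable_snd this, of "bernoulli_measure p"]
  have "snd -` {?x} \<inter> space (moebius_product p t) \<in> sets (moebius_product p t)"
    unfolding moebius_product_def .
  moreover have "snd -` {?x} \<inter> space (moebius_product p t) = {z \<in> UNIV \<times> {0..1}. snd z = ?x}"
    by auto
  ultimately have m: "{z \<in> UNIV \<times> {0..1}. snd z = ?x} \<in> sets (moebius_product p t)" by simp
  have "{z \<in> X. symbol z = (b, 0)} \<subseteq> {z \<in> UNIV \<times> {0..1}. snd z = ?x}"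
  proof
    fix z assume z: "z \<in> {z \<in> X. symbol z = (b, 0)}"
    then have "z \<in> UNIV \<times> {0..1}" using sets.sets_into_space[OF X] by auto
    moreover from z have "digit b (snd z) = 0" by (auto simp: symbol_def)
    ultimately show "z \<in> {z \<in> UNIV \<times> {0..1}. snd z = ?x}"
      using digit_eq_0D[of b "snd z"] by (cases z) auto
  qed
  from emeasure_mono[OF this m] show ?thesis
    using moebius_product_snd_null[OF assms(1), of p ?x] by simp
qed

text \<open>The first coordinate of the stream is independent of its tail, so fixing the first
  symbol leaves the Bernoulli factor unchanged and only moves the parameter of the fibre factor. The
  constant is the probability of \<open>b\<close> times the constant of the fibre branch.\<close>

lemma moebius_product_branch_factor:
  assumes k: "1 \<le> k" and t: "0 \<le> t"
  shows "\<exists>c. \<forall>S\<in>sets (moebius_product p 0).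
    emeasure (moebius_product p t) {z \<in> UNIV \<times> {0..1}. symbol z = (b, k) \<and> random_cf_map z \<in> S}
      = c * emeasure (moebius_product p (branch_param b k t)) S"
proof -
  let ?t = "branch_param b k t"
  let ?m = "bernoulli_measure p" and ?B = "measure_pmf (bernoulli_pmf (1 - p))"
  have t': "0 \<le> ?t" using k t by (rule branch_param_nonneg)
  interpret G: prob_space "moebius_measure t" using t by (rule prob_space_moebius_measure)
  interpret G': prob_space "moebius_measure ?t" using t' by (rule prob_space_moebius_measure)
  obtain c where c: "\<And>B. B \<in> sets unit_lebesgue \<Longrightarrow>
      emeasure (moebius_measure t) {x \<in> {0..1}. digit b x = k \<and> fibre_map b x \<in> B}
      = c * emeasure (moebius_measure ?t) B"
    using moebius_measure_branch[OF k t] by blast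
  have "emeasure (moebius_product p t) {z \<in> UNIV \<times> {0..1}. symbol z = (b, k) \<and> random_cf_map z \<in> S}
      = (c * emeasure ?B {b}) * emeasure (moebius_product p ?t) S"
    if S: "S \<in> sets (moebius_product p 0)" for S
  proof -
    let ?X = "{z \<in> UNIV \<times> {0..1}. symbol z = (b, k) \<and> random_cf_map z \<in> S}"
    have S': "S \<in> sets (?m \<Otimes>\<^sub>M moebius_measure ?t)"
      using S sets_moebius_product by (auto simp: moebius_product_def)
    have "{z \<in> random_cf_map -` S \<inter> space (moebius_product p t). symbol z = (b, k)}
        \<in> sets (moebius_product p t)"
      by (intro symbol_set measurable_sets[OF random_cf_map_measurable_moebius S])
    moreover have "{z \<in> random_cf_map -` S \<inter> space (moebius_product p t). symbol z = (b, k)} = ?X"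
      by auto
    ultimately have X: "?X \<in> sets (?m \<Otimes>\<^sub>M moebius_measure t)" by (simp add: moebius_product_def)
    have meas: "(\<lambda>\<omega>. emeasure (moebius_measure t) (Pair \<omega> -` ?X)) \<in> borel_measurable ?m"
      using X by (rule G.measurable_emeasure_Pair)
    have slice: "emeasure (moebius_measure t) (Pair (b' ## \<omega>) -` ?X)
        = (c * emeasure (moebius_measure ?t) (Pair \<omega> -` S)) * indicator {b} b'" for b' \<omega>
    proof (cases "b' = b")
      case True
      have S\<omega>: "Pair \<omega> -` S \<in> sets unit_lebesgue" using sets_Pair1[OF S'] by simp
      have eq: "Pair (b' ## \<omega>) -` ?X
          = {x \<in> {0..1}. digit b x = k \<and> fibre_map b x \<in> Pair \<omega> -` S}"
        using True by (auto simp: symbol_def random_cf_map_eq)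
      show ?thesis unfolding eq c[OF S\<omega>] using True by simp
    next
      case False
      then have eq: "Pair (b' ## \<omega>) -` ?X = {}" by (auto simp: symbol_def)
      show ?thesis unfolding eq using False by simp
    qed
    have "emeasure (moebius_product p t) ?X = (\<integral>\<^sup>+\<omega>. emeasure (moebius_measure t) (Pair \<omega> -` ?X) \<partial>?m)"
      using X unfolding moebius_product_def by (rule G.emeasure_pair_measure_alt)
    \<comment> \<open>The Bernoulli measure is disintegrated along its first coordinate; by
      \<open>slice\<close> only the value \<open>b\<close> contributes, and what is left is the
      integral over the tail.\<close>
    also have "\<dots> = (\<integral>\<^sup>+b'. (\<integral>\<^sup>+\<omega>. emeasure (moebius_measure t) (Pair (b' ## \<omega>) -` ?X) \<partial>?m) \<partial>?B)"
      using meas unfolding bernoulli_measure_def by (rule prob_space.nn_integral_stream_space[OF measure_pmf.prob_space_axioms])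
    also have "\<dots> = (\<integral>\<^sup>+b'. c * emeasure (moebius_product p ?t) S * indicator {b} b' \<partial>?B)"
      unfolding slice using G'.measurable_emeasure_Pair[OF S']
      by (simp add: nn_integral_multc nn_integral_cmult moebius_product_def
          G'.emeasure_pair_measure_alt[OF S'])
    also have "\<dots> = (c * emeasure ?B {b}) * emeasure (moebius_product p ?t) S"
      by (subst nn_integral_cmult_indicator) (auto simp: mult_ac)
    finally show ?thesis .
  qed
  then show ?thesis by blast
qed

text \<open>Taking the whole space for \<open>S\<close> identifies the unknown constant as the mass
  of the piece, because the image measure is a multiple of a probability measure.\<close>

lemma moebius_product_branch:
  assumes k: "1 \<le> k" and t: "0 \<le> t" and S: "S \<in> sets (moebius_product p 0)"
  shows "emeasure (moebius_product p t) {z \<in> UNIV \<times> {0..1}. symbol z = (b, k) \<and> random_cf_map z \<in> S}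
    = emeasure (moebius_product p t) {z \<in> UNIV \<times> {0..1}. symbol z = (b, k)}
      * emeasure (moebius_product p (branch_param b k t)) S"
proof -
  obtain c where c: "\<And>S. S \<in> sets (moebius_product p 0) \<Longrightarrow>
    emeasure (moebius_product p t) {z \<in> UNIV \<times> {0..1}. symbol z = (b, k) \<and> random_cf_map z \<in> S}
      = c * emeasure (moebius_product p (branch_param b k t)) S"
    using moebius_product_branch_factor[OF k t] by blast
  interpret G: prob_space "moebius_product p (branch_param b k t)"
    by (intro prob_space_moebius_product branch_param_nonneg k t)
  have "random_cf_map z \<in> UNIV \<times> {0..1}" for z
    using fibre_map_in_unit by (simp add: random_cf_map_eq)
  then have "{z \<in> UNIV \<times> {0..1}. symbol z = (b, k) \<and> random_cf_map z \<in> UNIV \<times> {0..1}}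
      = {z \<in> UNIV \<times> {0..1}. symbol z = (b, k)}" by auto
  moreover have "UNIV \<times> {0..1} \<in> sets (moebius_product p 0)"
    using sets.top[of "moebius_product p 0"] by simp
  ultimately have "emeasure (moebius_product p t) {z \<in> UNIV \<times> {0..1}. symbol z = (b, k)} = c"
    using c[of "UNIV \<times> {0..1}"] G.emeasure_space_1 by simp
  then show ?thesis using c[OF S] by simp
qed

lemma random_cf_map_in_space: "random_cf_map z \<in> UNIV \<times> {0..1}"
  using fibre_map_in_unit by (simp add: random_cf_map_eq)

lemma random_cf_map_vimage:
  assumes "S \<in> sets (moebius_product p 0)"
  shows "{z \<in> UNIV \<times> {0..1}. random_cf_map z \<in> S} \<in> sets (moebius_product p t)"
proof -
  have "{z \<in> UNIV \<times> {0..1}. random_cf_map z \<in> S} = random_cf_map -` S \<inter> space (moebius_product p t)"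
    by auto
  then show ?thesis using measurable_sets[OF random_cf_map_measurable_moebius assms] by simp
qed

lemma emeasure_moebius_product_symbols:
  assumes X: "X \<in> sets (moebius_product p t)"
  shows "emeasure (moebius_product p t) X
    = (\<integral>\<^sup>+a. emeasure (moebius_product p t) {z \<in> X. symbol z = a} \<partial>count_space UNIV)"
proof -
  have "X = (\<Union>a. {z \<in> X. symbol z = a})" by auto
  also have "emeasure (moebius_product p t) \<dots>
      = (\<integral>\<^sup>+a. emeasure (moebius_product p t) {z \<in> X. symbol z = a} \<partial>count_space UNIV)"
    by (intro emeasure_UN_countable symbol_set X) (auto simp: disjoint_family_on_def)
  finally show ?thesis .
qed

lemma symbols_measurable:
  assumes "\<And>a. X a \<in> sets (moebius_product p 0)"
  shows "{z \<in> UNIV \<times> {0..1}. random_cf_map z \<in> X (symbol z)} \<in> sets (moebius_product p t)"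
proof -
  have "{z \<in> UNIV \<times> {0..1}. random_cf_map z \<in> X (symbol z)}
      = (\<Union>a. {z \<in> {z \<in> UNIV \<times> {0..1}. random_cf_map z \<in> X a}. symbol z = a})" by auto
  also have "\<dots> \<in> sets (moebius_product p t)"
    using symbol_set[OF random_cf_map_vimage[OF assms]] by (intro sets.countable_UN'') auto
  finally show ?thesis .
qed

text \<open>One step turns the measure with parameter t into a countable mixture of the measures
  with parameters \<open>branch_param b k t\<close>, weighted by the masses of the pieces; an
  inequality for every component passes to the mixture. The targets may depend on the first symbol,
  so that conditions on a whole word can be handled one letter at a time.\<close>

lemma moebius_product_lower_superposition:
  assumes t: "0 \<le> t"
    and sets: "\<And>a. X a \<in> sets (moebius_product p 0)" "\<And>a. Y a \<in> sets (moebius_product p 0)"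
    and le: "\<And>b k. 1 \<le> k \<Longrightarrow> L * emeasure (moebius_product p (branch_param b k t)) (X (b, k))
      \<le> emeasure (moebius_product p (branch_param b k t)) (Y (b, k))"
  shows "L * emeasure (moebius_product p t) {z \<in> UNIV \<times> {0..1}. random_cf_map z \<in> X (symbol z)}
    \<le> emeasure (moebius_product p t) {z \<in> UNIV \<times> {0..1}. random_cf_map z \<in> Y (symbol z)}"
proof -
  let ?E = "emeasure (moebius_product p t)"
  let ?P = "\<lambda>X. {z \<in> UNIV \<times> {0..1}. random_cf_map z \<in> X (symbol z)}"
  note PX = symbols_measurable[of X p t, OF sets(1)] and PY = symbols_measurable[of Y p t, OF sets(2)]
  have piece: "{z \<in> ?P X. symbol z = a} = {z \<in> UNIV \<times> {0..1}. symbol z = a \<and> random_cf_map z \<in> X a}"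
    for X a by auto
  have "L * ?E {z \<in> ?P X. symbol z = a} \<le> ?E {z \<in> ?P Y. symbol z = a}" for a
  proof (cases a)
    case (Pair b k)
    show ?thesis
    proof (cases "k = 0")
      case True
      then show ?thesis using symbol_0_null[OF t PX, of b] Pair by simp
    next
      case False
      then have k: "1 \<le> k" by simp
      show ?thesis
        unfolding piece Pair moebius_product_branch[OF k t sets(1)] moebius_product_branch[OF k t sets(2)]
        using mult_left_mono[OF le[OF k, of b], of "?E {z \<in> UNIV \<times> {0..1}. symbol z = (b, k)}"]
        by (simp add: mult_ac)
    qed
  qed
  then have "(\<integral>\<^sup>+a. L * ?E {z \<in> ?P X. symbol z = a} \<partial>count_space UNIV)
      \<le> (\<integral>\<^sup>+a. ?E {z \<in> ?P Y. symbol z = a} \<partial>count_space UNIV)"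
    by (intro nn_integral_mono) auto
  then show ?thesis
    using emeasure_moebius_product_symbols[OF PX] emeasure_moebius_product_symbols[OF PY]
    by (simp add: nn_integral_cmult)
qed

text \<open>The image of the reference measure is a mixture of members of the family, each
  absolutely continuous with respect to it.\<close>

lemma random_cf_map_nonsingular:
  "absolutely_continuous (moebius_product p 0)
    (distr (moebius_product p 0) (moebius_product p 0) random_cf_map)"
  unfolding absolutely_continuous_def
proof
  let ?M = "moebius_product p 0"
  fix A assume A: "A \<in> null_sets ?M"
  then have sets: "A \<in> sets ?M" by auto
  have "emeasure ?M {z \<in> {z \<in> UNIV \<times> {0..1}. random_cf_map z \<in> A}. symbol z = a} = 0" for a
  proof (cases a)
    case (Pair b k)
    show ?thesis
    proof (cases "k = 0")
      case True
      then show ?thesis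
        using symbol_0_null[OF _ random_cf_map_vimage[OF sets], of 0 b] Pair by simp
    next
      case False
      then have k: "1 \<le> k" by simp
      have "A \<in> null_sets (moebius_product p (branch_param b k 0))"
        using A absolutely_continuous_moebius_product[OF branch_param_nonneg[OF k order.refl]]
        by (auto simp: absolutely_continuous_def)
      moreover have "{z \<in> {z \<in> UNIV \<times> {0..1}. random_cf_map z \<in> A}. symbol z = a}
          = {z \<in> UNIV \<times> {0..1}. symbol z = (b, k) \<and> random_cf_map z \<in> A}"
        using Pair by auto
      ultimately show ?thesis
        using moebius_product_branch[OF k order.refl sets, of b] by (simp add: null_setsD1)
    qed
  qed
  then have "emeasure ?M {z \<in> UNIV \<times> {0..1}. random_cf_map z \<in> A} = 0"
    using emeasure_moebius_product_symbols[OF random_cf_map_vimage[OF sets], of 0] by simp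
  moreover have "random_cf_map -` A \<inter> space ?M = {z \<in> UNIV \<times> {0..1}. random_cf_map z \<in> A}"
    by auto
  ultimately show "A \<in> null_sets (distr ?M ?M random_cf_map)"
    using sets random_cf_map_vimage[OF sets, of 0] random_cf_map_measurable_moebius[of p 0 0]
    by (simp add: null_sets_def emeasure_distr)
qed

section \<open>Domination of the reference measure after any positive number of steps\<close>

lemma moebius_product_heads:
  assumes "0 \<le> p" "p \<le> 1" "0 \<le> t"
  shows "emeasure (moebius_product p t) {z \<in> UNIV \<times> {0..1}. \<not> shd (fst z)} = ennreal p"
proof -
  interpret G: prob_space "moebius_measure t" using assms(3) by (rule prob_space_moebius_measure)
  interpret S: prob_space "bernoulli_measure p" by (rule prob_space_bernoulli_measure)
  let ?B = "measure_pmf (bernoulli_pmf (1 - p))"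
  have hd: "shd \<in> measurable (bernoulli_measure p) (count_space UNIV)"
  proof -
    have "shd \<in> measurable (bernoulli_measure p) ?B" unfolding bernoulli_measure_def by measurable
    then show ?thesis by simp
  qed
  have "shd -` {False} \<inter> space (bernoulli_measure p) \<in> sets (bernoulli_measure p)"
    by (rule measurable_sets[OF hd]) simp
  then have m: "{\<omega>. \<not> shd \<omega>} \<in> sets (bernoulli_measure p)" by (simp add: vimage_def)
  have "{z \<in> UNIV \<times> {0..1}. \<not> shd (fst z)} = {\<omega>. \<not> shd \<omega>} \<times> space (moebius_measure t)" by auto
  then have "emeasure (moebius_product p t) {z \<in> UNIV \<times> {0..1}. \<not> shd (fst z)}
      = emeasure (bernoulli_measure p) {\<omega>. \<not> shd \<omega>}"
    using G.emeasure_pair_measure_Times[OF m sets.top] G.emeasure_space_1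
    by (simp only: moebius_product_def mult_1_right)
  also have "\<dots> = (\<integral>\<^sup>+b. emeasure (bernoulli_measure p) {\<omega> \<in> space (bernoulli_measure p). b ## \<omega> \<in> {\<omega>. \<not> shd \<omega>}} \<partial>?B)"
    using prob_space.emeasure_stream_space[OF measure_pmf.prob_space_axioms m[unfolded bernoulli_measure_def]]
    unfolding bernoulli_measure_def .
  also have "\<dots> = (\<integral>\<^sup>+b. indicator {False} b \<partial>?B)"
  proof (rule nn_integral_cong)
    fix b
    show "emeasure (bernoulli_measure p) {\<omega> \<in> space (bernoulli_measure p). b ## \<omega> \<in> {\<omega>. \<not> shd \<omega>}}
      = indicator {False} b"
      using S.emeasure_space_1 by (cases b) auto
  qed
  also have "\<dots> = ennreal p"
    using assms by (simp add: emeasure_pmf_single)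
  finally show ?thesis .
qed

lemma funpow_random_cf_map_measurable:
  "random_cf_map ^^ n \<in> measurable (moebius_product p 0) (moebius_product p 0)"
  by (induction n) (auto intro: measurable_compose[OF _ random_cf_map_measurable_moebius] simp: comp_def)

text \<open>The induction removes the first step and changes the parameter, so the claim is needed
  for every t >= 0 with one constant, and the base case is the last step in time.\<close>

lemma moebius_product_funpow_lower:
  assumes p: "0 \<le> p" "p \<le> 1" and t: "0 \<le> t" and A: "A \<in> sets (moebius_product p 0)"
  shows "ennreal (p / 2) * emeasure (moebius_product p 0) A
    \<le> emeasure (moebius_product p t) {z \<in> UNIV \<times> {0..1}. (random_cf_map ^^ Suc n) z \<in> A}"
  using t
proof (induction n arbitrary: t)
  case 0
  let ?L = "ennreal (1 / 2) * emeasure (moebius_product p 0) A"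
  \<comment> \<open>Only Gauss pieces are counted. After a Renyi step the parameter may exceed 1, so
    for those pieces the left side is made zero by the empty set.\<close>
  define X where "X a = (if fst a then {} else UNIV \<times> {0..1} :: (bool stream \<times> real) set)"
    for a :: "bool \<times> nat"
  have "?L * emeasure (moebius_product p t) {z \<in> UNIV \<times> {0..1}. random_cf_map z \<in> X (symbol z)}
    \<le> emeasure (moebius_product p t) {z \<in> UNIV \<times> {0..1}. random_cf_map z \<in> A}"
  proof (rule moebius_product_lower_superposition[OF 0])
    show "X a \<in> sets (moebius_product p 0)" for a
      using sets.top[of "moebius_product p 0"] by (simp add: X_def)
    fix b :: bool and k :: nat assume k: "1 \<le> k"
    interpret G: prob_space "moebius_product p (branch_param b k t)"
      by (intro prob_space_moebius_product branch_param_nonneg k 0)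
    show "?L * emeasure (moebius_product p (branch_param b k t)) (X (b, k))
      \<le> emeasure (moebius_product p (branch_param b k t)) A"
    proof (cases b)
      case False
      then have "?L \<le> emeasure (moebius_product p (branch_param b k t)) A"
        using branch_param_False_le_1[OF k 0] branch_param_nonneg[OF k 0]
        by (intro moebius_product_lower A) auto
      then show ?thesis using False G.emeasure_space_1 by (simp add: X_def)
    qed (simp add: X_def)
  qed (rule A)
  moreover have "{z \<in> UNIV \<times> {0..1}. random_cf_map z \<in> X (symbol z)}
      = {z \<in> UNIV \<times> {0..1}. \<not> shd (fst z)}"
    using random_cf_map_in_space by (auto simp: X_def symbol_def)
  moreover have "ennreal (p / 2) = ennreal (1 / 2) * ennreal p"
    using p by (subst ennreal_mult[symmetric]) auto
  ultimately show ?case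
    using moebius_product_heads[OF p 0] by (simp add: mult_ac)
next
  case (Suc n)
  define Y where "Y = {z \<in> UNIV \<times> {0..1 :: real}. (random_cf_map ^^ Suc n) z \<in> A}"
  let ?L = "ennreal (p / 2) * emeasure (moebius_product p 0) A"
  interpret G: prob_space "moebius_product p t" using Suc.prems by (rule prob_space_moebius_product)
  have "Y = (random_cf_map ^^ Suc n) -` A \<inter> space (moebius_product p 0)"
    by (auto simp: Y_def simp del: funpow.simps)
  then have Y: "Y \<in> sets (moebius_product p 0)" using measurable_sets[OF funpow_random_cf_map_measurable A, of "Suc n"] by (simp only:)
  \<comment> \<open>With the whole space on the left, of mass one under every parameter, the
    superposition inequality averages the induction hypothesis, whose bound \<open>?L\<close> does
    not depend on the parameter.\<close>
  have "?L * emeasure (moebius_product p t) {z \<in> UNIV \<times> {0..1}. random_cf_map z \<in> UNIV \<times> {0..1}}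
    \<le> emeasure (moebius_product p t) {z \<in> UNIV \<times> {0..1}. random_cf_map z \<in> Y}"
  proof (rule moebius_product_lower_superposition[OF Suc.prems])
    show "UNIV \<times> {0..1} \<in> sets (moebius_product p 0)"
      using sets.top[of "moebius_product p 0"] by simp
    fix b :: bool and k :: nat assume k: "1 \<le> k"
    interpret G': prob_space "moebius_product p (branch_param b k t)"
      by (intro prob_space_moebius_product branch_param_nonneg k Suc.prems)
    show "?L * emeasure (moebius_product p (branch_param b k t)) (UNIV \<times> {0..1})
      \<le> emeasure (moebius_product p (branch_param b k t)) Y"
      using Suc.IH[OF branch_param_nonneg[OF k Suc.prems], of b] G'.emeasure_space_1
      by (simp add: Y_def del: funpow.simps)
  qed (rule Y)
  moreover have "{z \<in> UNIV \<times> {0..1}. random_cf_map z \<in> Y}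
      = {z \<in> UNIV \<times> {0..1}. (random_cf_map ^^ Suc (Suc n)) z \<in> A}"
    using random_cf_map_in_space unfolding Y_def
    by (auto simp: funpow_Suc_right simp del: funpow.simps)
  moreover have "{z \<in> UNIV \<times> {0..1}. random_cf_map z \<in> UNIV \<times> {0..1}} = UNIV \<times> {0..1}"
    using random_cf_map_in_space by auto
  ultimately show ?case using G.emeasure_space_1 by simp
qed

section \<open>Words of symbols and domination from within a cylinder\<close>

primrec itinerary :: "nat \<Rightarrow> bool stream \<times> real \<Rightarrow> (bool \<times> nat) list" where
  "itinerary 0 z = []"
| "itinerary (Suc n) z = symbol z # itinerary n (random_cf_map z)"

lemma itinerary_take: "take n (itinerary (n + m) z) = itinerary n z"
  by (induction n arbitrary: z) auto

lemma itinerary_measurable: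
  "{z \<in> UNIV \<times> {0..1}. itinerary n z \<in> W} \<in> sets (moebius_product p t)"
proof (induction n arbitrary: W t)
  case 0
  then show ?case using sets.top[of "moebius_product p t"] by (cases "[] \<in> W") auto
next
  case (Suc n)
  have "{z \<in> UNIV \<times> {0..1}. itinerary (Suc n) z \<in> W}
    = {z \<in> UNIV \<times> {0..1}. random_cf_map z
        \<in> {z' \<in> UNIV \<times> {0..1}. itinerary n z' \<in> {w. symbol z # w \<in> W}}}"
    using random_cf_map_in_space by auto
  then show ?case
    using symbols_measurable[of "\<lambda>a. {z' \<in> UNIV \<times> {0..1}. itinerary n z' \<in> {w. a # w \<in> W}}" p t, OF Suc.IH]
    by simp
qed

text \<open>Once the first \<open>n\<close> symbols are read, the image is again a member of the
  family, so the bound for a positive number of further steps applies. The time exceeds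
  \<open>n\<close> by \<open>Suc m\<close> because the resetting Gauss step must come after the
  word. Any set \<open>W\<close> of words is allowed, which covers unions of cylinders at once; the
  induction replaces it by its tails after the first symbol.\<close>

lemma moebius_product_itinerary_lower:
  assumes p: "0 \<le> p" "p \<le> 1" and t: "0 \<le> t" and A: "A \<in> sets (moebius_product p 0)"
  shows "ennreal (p / 2) * emeasure (moebius_product p 0) A
      * emeasure (moebius_product p t) {z \<in> UNIV \<times> {0..1}. itinerary n z \<in> W}
    \<le> emeasure (moebius_product p t)
        {z \<in> UNIV \<times> {0..1}. itinerary n z \<in> W \<and> (random_cf_map ^^ Suc (n + m)) z \<in> A}"
  using t
proof (induction n arbitrary: t W)
  case 0
  interpret G: prob_space "moebius_product p t" using 0 by (rule prob_space_moebius_product)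
  show ?case
    using moebius_product_funpow_lower[OF p 0 A, of m] G.emeasure_space_1
    by (cases "[] \<in> W") (auto simp del: funpow.simps)
next
  case (Suc n)
  define X where "X a = {z \<in> UNIV \<times> {0..1 :: real}. itinerary n z \<in> {w. a # w \<in> W}}" for a
  define Y where "Y a = {z \<in> UNIV \<times> {0..1 :: real}. itinerary n z \<in> {w. a # w \<in> W}
      \<and> (random_cf_map ^^ Suc (n + m)) z \<in> A}" for a
  have X: "X a \<in> sets (moebius_product p 0)" for a
    unfolding X_def by (rule itinerary_measurable)
  have "Y a = X a \<inter> ((random_cf_map ^^ Suc (n + m)) -` A \<inter> space (moebius_product p 0))" for a
    by (auto simp: X_def Y_def simp del: funpow.simps)
  then have Y: "Y a \<in> sets (moebius_product p 0)" for a
    using measurable_sets[OF funpow_random_cf_map_measurable A] X by (metis sets.Int)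
  have eqX: "{z \<in> UNIV \<times> {0..1}. itinerary (Suc n) z \<in> W}
      = {z \<in> UNIV \<times> {0..1}. random_cf_map z \<in> X (symbol z)}"
    using random_cf_map_in_space by (auto simp: X_def)
  have eqY: "{z \<in> UNIV \<times> {0..1}. itinerary (Suc n) z \<in> W \<and> (random_cf_map ^^ Suc (Suc n + m)) z \<in> A}
      = {z \<in> UNIV \<times> {0..1}. random_cf_map z \<in> Y (symbol z)}"
    using random_cf_map_in_space by (auto simp: Y_def funpow_Suc_right simp del: funpow.simps)
  show ?case
    unfolding eqX eqY
  proof (rule moebius_product_lower_superposition[OF Suc.prems X Y])
    fix b :: bool and k :: nat assume "1 \<le> k"
    then show "ennreal (p / 2) * emeasure (moebius_product p 0) A
        * emeasure (moebius_product p (branch_param b k t)) (X (b, k))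
      \<le> emeasure (moebius_product p (branch_param b k t)) (Y (b, k))"
      using Suc.IH[OF branch_param_nonneg[OF _ Suc.prems], of k b "{w. (b, k) # w \<in> W}"]
      unfolding X_def Y_def by blast
  qed
qed

section \<open>Approximation by cylinders\<close>

text \<open>For two points at distance d, of which the smaller is v and the larger u, one has k + u
  >= 1 + d and k + v >= 1, so their images are at distance at most d / (1 + d). This bound takes 1 /
  (n + 1) to 1 / (n + 2), and it is attained at k = 1, v = 0, the neutral case.\<close>

lemma inverse_branch_contraction:
  assumes k: "1 \<le> k" and y: "y \<in> {0..1}" "y' \<in> {0..1}" and le: "\<bar>y - y'\<bar> \<le> 1 / (real n + 1)"
  shows "\<bar>1 / (real k + y) - 1 / (real k + y')\<bar> \<le> 1 / (real n + 2)"
proof -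
  have *: "1 / (real k + v) - 1 / (real k + u) \<le> 1 / (real n + 2)"
    if uv: "0 \<le> v" "v \<le> u" "u - v \<le> 1 / (real n + 1)" for u v
  proof -
    define d where "d = u - v"
    have d: "0 \<le> d" "d * (real n + 1) \<le> 1" using uv by (auto simp: d_def field_simps)
    have "(1 + d) * 1 \<le> (real k + u) * (real k + v)"
      using uv k d by (intro mult_mono) (auto simp: d_def)
    moreover have "1 / (real k + v) - 1 / (real k + u) = d / ((real k + u) * (real k + v))"
      using uv k by (simp add: d_def field_simps)
    ultimately have "1 / (real k + v) - 1 / (real k + u) \<le> d / (1 + d)"
      using d by (simp add: frac_le)
    also have "\<dots> \<le> 1 / (real n + 2)"
      using d by (simp add: field_simps)
    finally show ?thesis .
  qed
  show ?thesis
  proof (cases "y \<le> y'")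
    case True
    then have "1 / (real k + y') \<le> 1 / (real k + y)" using y k by (intro divide_left_mono) auto
    then show ?thesis using *[of y y'] True y le by auto
  next
    case False
    then have "1 / (real k + y) \<le> 1 / (real k + y')" using y k by (intro divide_left_mono) auto
    then show ?thesis using *[of y' y] False y le by auto
  qed
qed

lemma itinerary_eq_imp_close:
  assumes "snd z \<in> {0..1}" "snd z' \<in> {0..1}" "itinerary n z = itinerary n z'"
  shows "\<bar>snd z - snd z'\<bar> \<le> 1 / (real n + 1)"
  using assms
proof (induction n arbitrary: z z')
  case 0
  then show ?case by auto
next
  case (Suc n)
  obtain b k where bk: "symbol z = (b, k)" by (cases "symbol z")
  with Suc.prems have bk': "symbol z' = (b, k)" by simp
  define x x' where "x = (if b then 1 - snd z else snd z)" and "x' = (if b then 1 - snd z' else snd z')"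
  have d: "digit False x = k" "digit False x' = k"
    using bk bk' by (auto simp: symbol_def x_def x'_def digit_True split: if_splits)
  have R: "fibre_map False x = snd (random_cf_map z)" "fibre_map False x' = snd (random_cf_map z')"
    using bk bk' by (auto simp: symbol_def x_def x'_def fibre_map_True random_cf_map_eq split: if_splits)
  have "\<bar>x - x'\<bar> \<le> 1 / (real n + 2)"
  proof (cases "k = 0")
    \<comment> \<open>For digit 0 both points are the singular point of the same fibre map, hence
      equal.\<close>
    case True
    have "x \<in> {0..1}" "x' \<in> {0..1}" using Suc.prems by (auto simp: x_def x'_def)
    then have "x = 0" "x' = 0" using d True digit_eq_0D[of False x] digit_eq_0D[of False x'] by auto
    then show ?thesis by simp
  next
    case False
    then have k: "1 \<le> k" by simp
    have "\<bar>fibre_map False x - fibre_map False x'\<bar> \<le> 1 / (real n + 1)"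
      unfolding R using Suc.prems by (intro Suc.IH) (auto simp: random_cf_map_eq fibre_map_in_unit[simplified])
    then have "\<bar>1 / (real k + fibre_map False x) - 1 / (real k + fibre_map False x')\<bar> \<le> 1 / (real n + 2)"
      by (intro inverse_branch_contraction[OF k] fibre_map_in_unit)
    then show ?thesis
      using digit_False_eqD(1)[OF d(1) k] digit_False_eqD(1)[OF d(2) k] by simp
  qed
  moreover have "\<bar>x - x'\<bar> = \<bar>snd z - snd z'\<bar>" by (auto simp: x_def x'_def)
  ultimately show ?case by (simp add: add.commute)
qed

text \<open>Measurability of \<open>B\<close> is demanded separately because \<open>measure\<close>
  is 0 on nonmeasurable sets, where the inequality would hold for no reason.\<close>

definition itinerary_approximable :: "real \<Rightarrow> (bool stream \<times> real) set \<Rightarrow> bool" where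
  "itinerary_approximable p B \<longleftrightarrow> B \<in> sets (moebius_product p 0) \<and>
     (\<forall>e>0. \<exists>n W. measure (moebius_product p 0)
        (sym_diff B {z \<in> UNIV \<times> {0..1}. itinerary n z \<in> W}) < e)"

lemma itinerary_approximableI:
  assumes "\<And>z. z \<in> B \<longleftrightarrow> z \<in> UNIV \<times> {0..1} \<and> itinerary n z \<in> W"
  shows "itinerary_approximable p B"
proof -
  have B: "B = {z \<in> UNIV \<times> {0..1}. itinerary n z \<in> W}" using assms by auto
  show ?thesis
    unfolding itinerary_approximable_def
  proof (intro conjI allI impI exI)
    show "B \<in> sets (moebius_product p 0)" unfolding B by (rule itinerary_measurable)
    show "measure (moebius_product p 0) (sym_diff B {z \<in> UNIV \<times> {0..1}. itinerary n z \<in> W}) < e"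
      if "0 < e" for e
      unfolding B using that by simp
  qed
qed

lemma itinerary_approximable_compl:
  assumes "itinerary_approximable p B"
  shows "itinerary_approximable p (UNIV \<times> {0..1} - B)"
proof -
  have B: "B \<in> sets (moebius_product p 0)" using assms by (simp add: itinerary_approximable_def)
  then have sub: "B \<subseteq> UNIV \<times> {0..1}" using sets.sets_into_space[OF B] by simp
  show ?thesis
    unfolding itinerary_approximable_def
  proof (intro conjI allI impI)
    show "UNIV \<times> {0..1} - B \<in> sets (moebius_product p 0)"
      using sets.compl_sets[OF B] by simp
    fix e :: real assume "0 < e"
    then obtain n W where nW: "measure (moebius_product p 0)
        (sym_diff B {z \<in> UNIV \<times> {0..1}. itinerary n z \<in> W}) < e"
      using assms unfolding itinerary_approximable_def by blast
    have eq: "sym_diff (UNIV \<times> {0..1} - B) {z \<in> UNIV \<times> {0..1}. itinerary n z \<in> - W}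
        = sym_diff B {z \<in> UNIV \<times> {0..1}. itinerary n z \<in> W}"
      using sub by auto
    show "\<exists>n W. measure (moebius_product p 0)
        (sym_diff (UNIV \<times> {0..1} - B) {z \<in> UNIV \<times> {0..1}. itinerary n z \<in> W}) < e"
      using nW unfolding eq[symmetric] by blast
  qed
qed

lemma itinerary_approximable_Un:
  assumes B: "itinerary_approximable p B" and C: "itinerary_approximable p C"
  shows "itinerary_approximable p (B \<union> C)"
  unfolding itinerary_approximable_def
proof (intro conjI allI impI)
  interpret prob_space "moebius_product p 0" by (rule prob_space_moebius_product) simp
  have [measurable]: "B \<in> sets (moebius_product p 0)" "C \<in> sets (moebius_product p 0)"
    using B C by (auto simp: itinerary_approximable_def)
  then show "B \<union> C \<in> sets (moebius_product p 0)" by simp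
  fix e :: real assume "0 < e"
  then have "0 < e / 2" by simp
  let ?D = "\<lambda>n W. {z \<in> UNIV \<times> {0..1}. itinerary n z \<in> W}"
  have [measurable]: "?D n W \<in> sets (moebius_product p 0)" for n W by (rule itinerary_measurable)
  obtain n V where nV: "prob (sym_diff B (?D n V)) < e / 2"
    using B \<open>0 < e / 2\<close> unfolding itinerary_approximable_def by blast
  obtain m W where mW: "prob (sym_diff C (?D m W)) < e / 2"
    using C \<open>0 < e / 2\<close> unfolding itinerary_approximable_def by blast
  \<comment> \<open>The lengths of the two approximations may differ; a word of length n + m
    determines both prefixes.\<close>
  let ?U = "{w. take n w \<in> V \<or> take m w \<in> W}"
  have "?D (n + m) ?U = ?D n V \<union> ?D m W"
    using itinerary_take[of n m] itinerary_take[of m n] by (auto simp: add.commute)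
  then have "sym_diff (B \<union> C) (?D (n + m) ?U) \<subseteq> sym_diff B (?D n V) \<union> sym_diff C (?D m W)"
    by auto
  then have "prob (sym_diff (B \<union> C) (?D (n + m) ?U)) \<le> prob (sym_diff B (?D n V) \<union> sym_diff C (?D m W))"
    by (intro finite_measure_mono) auto
  also have "\<dots> \<le> prob (sym_diff B (?D n V)) + prob (sym_diff C (?D m W))"
    by (intro measure_Un_le) auto
  also have "\<dots> < e" using nV mW by simp
  finally show "\<exists>n W. prob (sym_diff (B \<union> C) (?D n W)) < e" by blast
qed

lemma itinerary_approximable_UN:
  fixes B :: "nat \<Rightarrow> (bool stream \<times> real) set"
  assumes B: "\<And>i. itinerary_approximable p (B i)"
  shows "itinerary_approximable p (\<Union>i. B i)"
  unfolding itinerary_approximable_def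
proof (intro conjI allI impI)
  interpret prob_space "moebius_product p 0" by (rule prob_space_moebius_product) simp
  have Bm [measurable]: "B i \<in> sets (moebius_product p 0)" for i
    using B by (auto simp: itinerary_approximable_def)
  then show U [measurable]: "(\<Union>i. B i) \<in> sets (moebius_product p 0)" by blast
  define C where "C m = (\<Union>i<m. B i)" for m
  have C: "itinerary_approximable p (C m)" for m
  proof (induction m)
    case 0
    show ?case by (rule itinerary_approximableI[of _ 0 "{}"]) (simp add: C_def)
  next
    case (Suc m)
    then show ?case using itinerary_approximable_Un[OF B[of m] Suc] by (simp add: C_def lessThan_Suc)
  qed
  have Cm [measurable]: "C m \<in> sets (moebius_product p 0)" for m
    using C by (auto simp: itinerary_approximable_def)
  fix e :: real assume "0 < e"
  then have e2: "0 < e / 2" by simp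
  \<comment> \<open>Continuity from below reduces the countable union to a finite one, at the cost
    of \<open>e / 2\<close>.\<close>
  have "incseq C" by (force simp: C_def incseq_def)
  then have "(\<lambda>m. prob (C m)) \<longlonglongrightarrow> prob (\<Union>m. C m)"
    using Cm by (intro finite_Lim_measure_incseq) auto
  moreover have CU: "(\<Union>m. C m) = (\<Union>i. B i)" by (auto simp: C_def)
  ultimately have "\<forall>\<^sub>F m in sequentially. prob (\<Union>i. B i) - e / 2 < prob (C m)"
    using e2 by (intro order_tendstoD(1)) auto
  then obtain m where "prob (\<Union>i. B i) - e / 2 < prob (C m)"
    by (auto simp: eventually_sequentially)
  moreover have sub: "C m \<subseteq> (\<Union>i. B i)" by (auto simp: C_def)
  ultimately have m: "prob ((\<Union>i. B i) - C m) < e / 2"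
    using finite_measure_Diff[OF U Cm[of m] sub] by simp
  let ?D = "\<lambda>n W. {z \<in> UNIV \<times> {0..1}. itinerary n z \<in> W}"
  have [measurable]: "?D n W \<in> sets (moebius_product p 0)" for n W by (rule itinerary_measurable)
  obtain n W where nW: "prob (sym_diff (C m) (?D n W)) < e / 2"
    using C[of m] e2 unfolding itinerary_approximable_def by blast
  have "prob (sym_diff (\<Union>i. B i) (?D n W)) \<le> prob (((\<Union>i. B i) - C m) \<union> sym_diff (C m) (?D n W))"
    using sub by (intro finite_measure_mono) auto
  also have "\<dots> \<le> prob ((\<Union>i. B i) - C m) + prob (sym_diff (C m) (?D n W))"
    by (intro measure_Un_le) auto
  also have "\<dots> < e" using nW m by simp
  finally show "\<exists>n W. prob (sym_diff (\<Union>i. B i) (?D n W)) < e" by blast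
qed

lemma itinerary_approximable_snth: "itinerary_approximable p {z \<in> UNIV \<times> {0..1}. fst z !! i}"
proof (rule itinerary_approximableI)
  \<comment> \<open>Stream positions start at 0, so a word of length \<open>Suc i\<close> is needed
    to see coordinate \<open>i\<close>.\<close>
  have "fst (itinerary (Suc i) z ! i) = fst z !! i" for z
  proof (induction i arbitrary: z)
    case (Suc i)
    from Suc[of "random_cf_map z"] show ?case by (simp add: random_cf_map_eq)
  qed (simp add: symbol_def)
  then show "z \<in> {z \<in> UNIV \<times> {0..1}. fst z !! i}
      \<longleftrightarrow> z \<in> UNIV \<times> {0..1} \<and> itinerary (Suc i) z \<in> {w. fst (w ! i)}" for z
    by (simp del: itinerary.simps)
qed

lemma itinerary_approximable_atMost: "itinerary_approximable p {z \<in> UNIV \<times> {0..1}. snd z \<le> a}"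
  unfolding itinerary_approximable_def
proof (intro conjI allI impI)
  interpret prob_space "moebius_product p 0" by (rule prob_space_moebius_product) simp
  interpret L: prob_space unit_lebesgue
    using prob_space_moebius_measure[of 0] by (simp add: moebius_measure_0)
  interpret S: prob_space "bernoulli_measure p" by (rule prob_space_bernoulli_measure)
  have mp: "moebius_product p 0 = bernoulli_measure p \<Otimes>\<^sub>M unit_lebesgue"
    by (simp add: moebius_product_def moebius_measure_0)
  have strip: "UNIV \<times> I \<in> sets (moebius_product p 0)"
    "emeasure (moebius_product p 0) (UNIV \<times> I) = emeasure lborel I"
    if "I \<in> sets borel" "I \<subseteq> {0..1}" for I
  proof -
    have I: "I \<in> sets unit_lebesgue" using that by (simp add: sets_unit_lebesgue_iff)
    have "UNIV \<in> sets (bernoulli_measure p)" using sets.top[of "bernoulli_measure p"] by simp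
    with I show "UNIV \<times> I \<in> sets (moebius_product p 0)" unfolding mp by simp
    have "emeasure (moebius_product p 0) (UNIV \<times> I) = emeasure (bernoulli_measure p) UNIV * emeasure unit_lebesgue I"
      unfolding mp using I sets.top[of "bernoulli_measure p"] by (intro L.emeasure_pair_measure_Times) auto
    also have "\<dots> = emeasure lborel I"
      using that S.emeasure_space_1 by (simp add: unit_lebesgue_def emeasure_restrict_space)
    finally show "emeasure (moebius_product p 0) (UNIV \<times> I) = emeasure lborel I" .
  qed
  have eqB: "{z \<in> UNIV \<times> {0..1}. snd z \<le> a} = UNIV \<times> ({0..1} \<inter> {..a})" by auto
  show B [measurable]: "{z \<in> UNIV \<times> {0..1}. snd z \<le> a} \<in> sets (moebius_product p 0)"
    unfolding eqB by (rule strip) auto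
  fix e :: real assume "0 < e"
  then obtain n where n: "1 / (real n + 1) < e"
    using reals_Archimedean[of e] by (auto simp: inverse_eq_divide add.commute)
  let ?B = "{z \<in> UNIV \<times> {0..1}. snd z \<le> a}"
  \<comment> \<open>All words met by the strip are taken, so the cylinder set contains it. An excess
    point shares its word with a point of the strip and thus lies at most 1 / (n + 1) to the right
    of \<open>a\<close>.\<close>
  let ?W = "itinerary n ` ?B"
  let ?D = "{z \<in> UNIV \<times> {0..1}. itinerary n z \<in> ?W}"
  let ?I = "{0..1} \<inter> {a..a + 1 / (real n + 1)}"
  have "sym_diff ?B ?D \<subseteq> UNIV \<times> ?I"
  proof
    fix z assume "z \<in> sym_diff ?B ?D"
    then have z: "z \<in> UNIV \<times> {0..1}" "a < snd z" "itinerary n z \<in> ?W" by auto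
    then obtain z' where z': "z' \<in> UNIV \<times> {0..1}" "snd z' \<le> a" "itinerary n z = itinerary n z'" by auto
    have "\<bar>snd z - snd z'\<bar> \<le> 1 / (real n + 1)"
      using z(1) z'(1,3) by (intro itinerary_eq_imp_close) auto
    with z z' show "z \<in> UNIV \<times> ?I" by (cases z) auto
  qed
  then have "emeasure (moebius_product p 0) (sym_diff ?B ?D) \<le> emeasure (moebius_product p 0) (UNIV \<times> ?I)"
    by (intro emeasure_mono strip) auto
  also have "\<dots> = emeasure lborel ?I" by (rule strip) auto
  also have "\<dots> \<le> emeasure lborel {a..a + 1 / (real n + 1)}" by (intro emeasure_mono) auto
  also have "\<dots> = ennreal (1 / (real n + 1))" by simp
  finally have "prob (sym_diff ?B ?D) \<le> 1 / (real n + 1)"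
    by (simp add: emeasure_eq_measure)
  then have "prob (sym_diff ?B ?D) < e" using n by linarith
  then show "\<exists>n W. prob (sym_diff ?B {z \<in> UNIV \<times> {0..1}. itinerary n z \<in> W}) < e" by blast
qed

text \<open>The approximable sets form a sigma-algebra for which all stream coordinates and the real
  coordinate are measurable. The identity is then measurable from it to the product space, so it
  contains every measurable set of the product.\<close>

lemma itinerary_approximable_sets:
  assumes B: "B \<in> sets (moebius_product p 0)"
  shows "itinerary_approximable p B"
proof -
  let ?\<Omega> = "UNIV \<times> {0..1} :: (bool stream \<times> real) set"
  let ?A = "Collect (itinerary_approximable p)"
  have sub: "?A \<subseteq> Pow ?\<Omega>"
  proof
    fix X assume "X \<in> ?A"
    then show "X \<in> Pow ?\<Omega>"
      using sets.sets_into_space[of X "moebius_product p 0"] by (simp add: itinerary_approximable_def)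
  qed
  have "sigma_algebra ?\<Omega> ?A"
    unfolding sigma_algebra_iff2
  proof (intro conjI ballI allI impI)
    show "?A \<subseteq> Pow ?\<Omega>" by (rule sub)
    have "itinerary_approximable p {}" by (rule itinerary_approximableI[of _ 0 "{}"]) simp
    then show "{} \<in> ?A" by simp
    show "?\<Omega> - s \<in> ?A" if "s \<in> ?A" for s
      using that itinerary_approximable_compl by simp
    show "(\<Union>i. A i) \<in> ?A" if "range A \<subseteq> ?A" for A :: "nat \<Rightarrow> _"
    proof -
      have "itinerary_approximable p (A i)" for i using that by auto
      then show ?thesis using itinerary_approximable_UN[of p A] by simp
    qed
  qed
  then interpret sigma_algebra ?\<Omega> ?A .
  define N where "N = sigma ?\<Omega> ?A"
  have sets_N: "sets N = ?A" unfolding N_def using sets_measure_of_eq by simp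
  have space_N: "space N = ?\<Omega>" unfolding N_def using sub by (simp add: space_measure_of)
  have "(\<lambda>z. fst z) \<in> measurable N (bernoulli_measure p)"
    unfolding bernoulli_measure_def
  proof (rule measurable_stream_space2)
    fix i
    have "Measurable.pred N (\<lambda>z. fst z !! i)"
      unfolding pred_def sets_N space_N using itinerary_approximable_snth by simp
    then show "(\<lambda>z. fst z !! i) \<in> measurable N (measure_pmf (bernoulli_pmf (1 - p)))" by simp
  qed
  moreover have "(\<lambda>z. snd z) \<in> measurable N unit_lebesgue"
  proof -
    have "snd \<in> borel_measurable N"
      unfolding borel_measurable_iff_le sets_N space_N using itinerary_approximable_atMost by simp
    then have "snd \<in> measurable N (restrict_space borel {0..1})"
      by (intro measurable_restrict_space2) (auto simp: space_N)
    then show ?thesis by (simp add: measurable_cong_sets[OF refl sets_unit_lebesgue])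
  qed
  ultimately have "(\<lambda>z. (fst z, snd z)) \<in> measurable N (bernoulli_measure p \<Otimes>\<^sub>M unit_lebesgue)"
    by (rule measurable_Pair)
  then have "(\<lambda>z. z) \<in> measurable N (moebius_product p 0)"
    by (simp add: measurable_cong_sets[OF refl sets_moebius_product])
  from measurable_sets[OF this B] have "B \<inter> ?\<Omega> \<in> sets N" by (simp add: space_N)
  moreover have "B \<inter> ?\<Omega> = B" using sets.sets_into_space[OF B] by auto
  ultimately show ?thesis by (simp add: sets_N)
qed

section \<open>The lower bound for the random map, and mixing\<close>

lemma random_cf_map_asymptotic_lower_bound:
  assumes p: "0 < p" "p \<le> 1"
  shows "asymptotic_lower_bound (moebius_product p 0) random_cf_map (p / 2)"
proof -
  let ?M = "moebius_product p 0"
  interpret prob_space ?M by (rule prob_space_moebius_product) simp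
  show ?thesis
  proof
    show "random_cf_map \<in> measurable ?M ?M" by (rule random_cf_map_measurable_moebius)
    show "absolutely_continuous ?M (distr ?M ?M random_cf_map)" by (rule random_cf_map_nonsingular)
    show "0 < p / 2" "p / 2 \<le> 1" using p by auto
    fix B :: "(bool stream \<times> real) set" and e :: real
    assume B [measurable]: "B \<in> sets ?M" and "0 < e"
    then have "0 < e / 2" by simp
    let ?D = "\<lambda>n W. {z \<in> UNIV \<times> {0..1}. itinerary n z \<in> W}"
    \<comment> \<open>The approximation error enters twice, in passing from \<open>B\<close> to the
      cylinder set on the left (there with a factor at most 1) and back again on the right; hence
      \<open>e / 2\<close>.\<close>
    obtain n W where nW: "prob (sym_diff B (?D n W)) < e / 2"
      using itinerary_approximable_sets[OF B] \<open>0 < e / 2\<close> unfolding itinerary_approximable_def by blast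
    have D [measurable]: "?D n W \<in> sets ?M" by (rule itinerary_measurable)
    show "\<exists>N. \<forall>m\<ge>N. \<forall>A\<in>sets ?M. p / 2 * prob B * prob A
        \<le> prob ((random_cf_map ^^ m) -` A \<inter> space ?M \<inter> B) + e"
    proof (intro exI allI impI ballI)
      \<comment> \<open>At least one step must follow the word of length \<open>n\<close>. The
        threshold depends on \<open>B\<close> and \<open>e\<close> but not on
        \<open>A\<close>.\<close>
      fix m A assume m: "Suc n \<le> m" and A [measurable]: "A \<in> sets ?M"
      obtain j where j: "m = Suc (n + j)" using m by (metis add_Suc le_iff_add)
      define X where "X = (random_cf_map ^^ m) -` A \<inter> space ?M"
      have [measurable]: "X \<in> sets ?M"
        unfolding X_def by (rule measurable_sets[OF funpow_random_cf_map_measurable A])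
      have "{z \<in> UNIV \<times> {0..1}. itinerary n z \<in> W \<and> (random_cf_map ^^ Suc (n + j)) z \<in> A} = X \<inter> ?D n W"
        unfolding X_def j by (auto simp del: funpow.simps)
      then have "ennreal (p / 2) * emeasure ?M A * emeasure ?M (?D n W) \<le> emeasure ?M (X \<inter> ?D n W)"
        using moebius_product_itinerary_lower[OF _ p(2) order.refl A, of n W j] p(1) by simp
      then have low: "p / 2 * prob A * prob (?D n W) \<le> prob (X \<inter> ?D n W)"
        using p(1) by (simp add: emeasure_eq_measure ennreal_mult[symmetric])
      have "prob B \<le> prob (?D n W \<union> sym_diff B (?D n W))" by (intro finite_measure_mono) auto
      also have "\<dots> \<le> prob (?D n W) + prob (sym_diff B (?D n W))"
        by (intro measure_Un_le) auto
      finally have BD: "prob B \<le> prob (?D n W) + e / 2" using nW by simp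
      have "prob (X \<inter> ?D n W) \<le> prob ((X \<inter> B) \<union> sym_diff B (?D n W))"
        by (intro finite_measure_mono) auto
      also have "\<dots> \<le> prob (X \<inter> B) + prob (sym_diff B (?D n W))"
        by (intro measure_Un_le) auto
      finally have XD: "prob (X \<inter> ?D n W) \<le> prob (X \<inter> B) + e / 2" using nW by simp
      have "p / 2 * prob A \<le> 1" using p by (intro mult_le_one) auto
      then have "p / 2 * prob A * (e / 2) \<le> 1 * (e / 2)"
        using \<open>0 < e\<close> by (intro mult_right_mono) auto
      moreover have "p / 2 * prob A * prob B \<le> p / 2 * prob A * (prob (?D n W) + e / 2)"
        using p BD by (intro mult_left_mono) auto
      ultimately have "p / 2 * prob A * prob B \<le> p / 2 * prob A * prob (?D n W) + e / 2"
        by (simp add: distrib_left)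
      then show "p / 2 * prob B * prob A \<le> prob ((random_cf_map ^^ m) -` A \<inter> space ?M \<inter> B) + e"
        unfolding X_def[symmetric] using low XD by (simp add: mult_ac)
    qed
  qed
qed

theorem theorem3p3:
  fixes p :: real and \<mu> :: "real measure"
  assumes "0 < p" and "p < 1"
    and "prob_space \<mu>"
    and "sets \<mu> = sets unit_lebesgue"
    and "absolutely_continuous unit_lebesgue \<mu>"
    and "has_bv_density \<mu>"
    and "invariant_measure random_cf_map (bernoulli_measure p \<Otimes>\<^sub>M \<mu>)"
  shows "mixing random_cf_map (bernoulli_measure p \<Otimes>\<^sub>M \<mu>)"
proof -
  let ?M = "bernoulli_measure p \<Otimes>\<^sub>M \<mu>" and ?L = "moebius_product p 0"
  \<comment> \<open>The merging result is used over the reference measure, and the invariant measure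
    enters only through measures absolutely continuous with respect to it.\<close>
  interpret asymptotic_lower_bound ?L random_cf_map "p / 2"
    using assms(1,2) by (intro random_cf_map_asymptotic_lower_bound) auto
  interpret P: prob_space ?M
    by (intro prob_space_pair prob_space_bernoulli_measure assms(3))
  have L: "?L = bernoulli_measure p \<Otimes>\<^sub>M unit_lebesgue"
    by (simp add: moebius_product_def moebius_measure_0)
  have sets: "sets ?M = sets ?L" unfolding L by (intro sets_pair_measure_cong assms(4) refl)
  then have space: "space ?M = space ?L" by (rule sets_eq_imp_space_eq)
  have "sigma_finite_measure unit_lebesgue"
    using prob_space_moebius_measure[of 0] by (simp add: moebius_measure_0 prob_space_imp_sigma_finite)
  then have ac: "absolutely_continuous ?L ?M"
    unfolding L using assms(3-5)
    by (intro absolutely_continuous_pair_measure) (auto simp: prob_space_imp_sigma_finite)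
  have ac_density: "absolutely_continuous ?L (density ?M f)" if "f \<in> borel_measurable ?M" for f
    using absolutely_continuousI_density[OF that] ac by (auto simp: absolutely_continuous_def)
  have invariant: "P.prob ((random_cf_map ^^ n) -` A \<inter> space ?M) = P.prob A" if A: "A \<in> sets ?M" for n A
  proof (induction n)
    case 0
    show ?case using sets.sets_into_space[OF A] by (simp add: Int_absorb2)
  next
    case (Suc n)
    let ?X = "(random_cf_map ^^ n) -` A \<inter> space ?M"
    have "?X \<in> sets ?M"
      using measurable_sets[OF funpow_measurable, of A n] A by (simp add: sets space)
    then have "emeasure ?M (random_cf_map -` ?X \<inter> space ?M) = emeasure ?M ?X"
      using assms(7) by (auto simp: invariant_measure_def)
    moreover have "random_cf_map -` ?X \<inter> space ?M = (random_cf_map ^^ Suc n) -` A \<inter> space ?M"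
      using random_cf_map_in_space unfolding space
      by (auto simp: funpow_Suc_right simp del: funpow.simps)
    ultimately show ?case using Suc by (simp add: measure_def del: funpow.simps)
  qed
  have "(\<lambda>n. P.prob ((random_cf_map ^^ n) -` A \<inter> space ?M \<inter> B)) \<longlonglongrightarrow> P.prob A * P.prob B"
    if A: "A \<in> sets ?M" and B [measurable]: "B \<in> sets ?M" for A B
  proof -
    define \<nu> \<nu>' where "\<nu> = density ?M (indicator B)" and "\<nu>' = density ?M (\<lambda>_. ennreal (P.prob B))"
    have \<nu>: "emeasure \<nu> X = P.prob (X \<inter> B)" and \<nu>': "emeasure \<nu>' X = P.prob B * P.prob X"
      if [measurable]: "X \<in> sets ?M" for X
      by (simp_all add: \<nu>_def \<nu>'_def emeasure_density indicator_inter_arith[symmetric]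
          Int_commute P.emeasure_eq_measure nn_integral_cmult ennreal_mult)
    have "(\<lambda>n. measure \<nu> ((random_cf_map ^^ n) -` A \<inter> space ?L)
        - measure \<nu>' ((random_cf_map ^^ n) -` A \<inter> space ?L)) \<longlonglongrightarrow> 0"
    proof (rule asymptotically_equal)
      show "finite_measure \<nu>" "finite_measure \<nu>'"
        using \<nu>[OF sets.top] \<nu>'[OF sets.top]
        by (auto intro!: finite_measureI simp: \<nu>_def \<nu>'_def)
      show "sets \<nu> = sets ?L" "sets \<nu>' = sets ?L" by (simp_all add: \<nu>_def \<nu>'_def sets)
      show "absolutely_continuous ?L \<nu>" "absolutely_continuous ?L \<nu>'"
        unfolding \<nu>_def \<nu>'_def by (rule ac_density, simp)+
      show "measure \<nu> (space ?L) = measure \<nu>' (space ?L)"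
        unfolding space[symmetric] using \<nu>[OF sets.top] \<nu>'[OF sets.top] sets.sets_into_space[OF B]
        by (simp add: measure_def P.emeasure_space_1 Int_absorb1)
      show "A \<in> sets ?L" using A by (simp add: sets)
    qed
    \<comment> \<open>By invariance the second term is the product of the two probabilities at every
      time, so the merging difference is exactly the correlation of \<open>A\<close> and
      \<open>B\<close>.\<close>
    moreover have "measure \<nu> ((random_cf_map ^^ n) -` A \<inter> space ?L)
        - measure \<nu>' ((random_cf_map ^^ n) -` A \<inter> space ?L)
      = P.prob ((random_cf_map ^^ n) -` A \<inter> space ?M \<inter> B) - P.prob A * P.prob B" for n
    proof -
      have "(random_cf_map ^^ n) -` A \<inter> space ?M \<in> sets ?M"
        using measurable_sets[OF funpow_measurable, of A n] A by (simp add: sets space)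
      from \<nu>[OF this] \<nu>'[OF this] show ?thesis
        unfolding space[symmetric] using invariant[OF A, of n] by (simp add: measure_def mult.commute)
    qed
    ultimately show ?thesis by (simp add: LIM_zero_iff)
  qed
  with assms(7) show ?thesis by (simp add: mixing_def)
qed

end
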